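(* For every knot $K$ in $S^3$ there exists a sequence of polynomials $a_{K,k}(q)\in\mathbb{Z}[q^{\pm1}]$, $k\ge0$, such that for all integers $n>0$ $$J_{K,n}(q)=\sum_{k=0}^{\infty}a_{K,k}(q)\,(q^{-n+1};q)_k .$$
   Context: $(a;q)_k=\prod_{i=0}^{k-1}(1-aq^i)$; for each fixed $n>0$ the sum is finite, since $(q^{-n+1};q)_k=0$ for $k\ge n$. $J_{K,n}(q)\in\mathbb{Z}[q^{\pm1}]$, $n\ge1$, is the colored Jones polynomial: the (framing-independent) quantum invariant of $K$ colored by the $n$-dimensional irreducible representation of $\mathfrak{sl}_2$, normalized to be $1$ on the unknot (so $J_{K,1}=1$ and $J_{K,2}$ is the Jones polynomial). *)

theory Defs
  imports
    "HOL-Analysis.Analysis"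
    "HOL-Library.Poly_Mapping"
    "HOL-Library.Groups_Big_Fun"
    "HOL-Combinatorics.Transposition"
begin

section \<open>Laurent polynomials\<close>

text \<open>
  The ring of integral Laurent polynomials in one variable is the group ring of the integers,
  i.e. the finitely supported functions from \<open>int\<close> to \<open>int\<close> with convolution. The variable is
  called \<open>q\<close> in the colored Jones polynomial itself; the representation theory
  of \<open>sl\<^sub>2\<close> uses the variable \<open>v = q\<^bsup>1/2\<^esup>\<close>.
\<close>

type_synonym laurent = "int \<Rightarrow>\<^sub>0 int"

definition var_pow :: "int \<Rightarrow> laurent" where
  "var_pow k = Poly_Mapping.single k 1"

text \<open>The embedding that substitutes \<open>q = v\<^sup>2\<close>.\<close>

definition subst_square :: "laurent \<Rightarrow> laurent" where
  "subst_square P = (\<Sum>k\<in>Poly_Mapping.keys P. Poly_Mapping.single (2 * k) (Poly_Mapping.lookup P k))"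

definition qpochhammer :: "'a \<Rightarrow> 'a \<Rightarrow> nat \<Rightarrow> 'a :: comm_ring_1" where
  "qpochhammer a q k = (\<Prod>i<k. 1 - a * q ^ i)"

text \<open>Balanced quantum integers \<open>[k] = (v\<^sup>k - v\<^bsup>-k\<^esup>) / (v - v\<^bsup>-1\<^esup>)\<close> and quantum
  binomial coefficients \<open>[m]! / ([k]! [m - k]!)\<close>, by the quantum Pascal rule.\<close>

definition qint :: "nat \<Rightarrow> laurent" where
  "qint k = (\<Sum>l<k. var_pow (int k - 1 - 2 * int l))"

fun qbinom :: "nat \<Rightarrow> nat \<Rightarrow> laurent" where
  "qbinom m 0 = 1"
| "qbinom 0 (Suc k) = 0"
| "qbinom (Suc m) (Suc k) =
     var_pow (int k + 1) * qbinom m (Suc k) + var_pow (int k - int m) * qbinom m k"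


section \<open>The irreducible representation of dimension n and its R-matrix\<close>

text \<open>
  The \<open>n\<close>-dimensional irreducible representation \<open>V\<^sub>n\<close> of quantum \<open>sl\<^sub>2\<close> has the basis
  \<open>e\<^sub>0, \<dots>, e\<^bsub>n-1\<^esub>\<close> with
    \<open>K e\<^sub>i = v\<^bsup>n-1-2i\<^esup> e\<^sub>i\<close>,  \<open>E e\<^sub>i = [n - i] e\<^bsub>i-1\<^esub>\<close>,  \<open>F e\<^sub>i = [i + 1] e\<^bsub>i+1\<^esub>\<close>.
  \<open>E_pow n k i r\<close> is the coefficient of \<open>e\<^sub>r\<close> in \<open>E\<^sup>k e\<^sub>i\<close>, and \<open>F_divpow n k j s\<close> that of
  \<open>e\<^sub>s\<close> in \<open>F\<^sup>k e\<^sub>j / [k]!\<close>; all indices are supposed to be below \<open>n\<close>.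
\<close>

definition K_weight :: "nat \<Rightarrow> nat \<Rightarrow> laurent" where
  "K_weight n i = var_pow (int n - 1 - 2 * int i)"

definition E_pow :: "nat \<Rightarrow> nat \<Rightarrow> nat \<Rightarrow> nat \<Rightarrow> laurent" where
  "E_pow n k i r = (if i = r + k then \<Prod>l<k. qint (n - i + l) else 0)"

definition F_divpow :: "nat \<Rightarrow> nat \<Rightarrow> nat \<Rightarrow> nat \<Rightarrow> laurent" where
  "F_divpow n k j s = (if s = j + k \<and> s < n then qbinom (j + k) k else 0)"

text \<open>
  The universal R-matrix is
    \<open>R = v\<^bsup>(H \<otimes> H)/2\<^esup> (\<Sum>k. v\<^bsup>k(k-1)/2\<^esup> (v - v\<^bsup>-1\<^esup>)\<^sup>k / [k]! E\<^sup>k \<otimes> F\<^sup>k)\<close>,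
  and a full positive twist of a ribbon colored by \<open>V\<^sub>n\<close> acts by \<open>v\<^bsup>(n\<^sup>2-1)/2\<^esup>\<close>. We divide \<open>R\<close>
  by this scalar, which makes the resulting link invariant independent of the framing. On
  \<open>e\<^sub>r \<otimes> e\<^sub>s\<close> the diagonal part then has the exponent
    \<open>((n-1-2r)(n-1-2s) - (n\<^sup>2-1)) / 2 = 2rs - (n-1)(r+s+1)\<close>.

  \<open>R_matrix n i j r s\<close> and \<open>R_inverse n i j r s\<close> are the coefficients of \<open>e\<^sub>r \<otimes> e\<^sub>s\<close> in the
  images of \<open>e\<^sub>i \<otimes> e\<^sub>j\<close>. Since \<open>E\<^sup>n = 0\<close> on \<open>V\<^sub>n\<close>, the sums stop at \<open>k = n - 1\<close>.
\<close>

definition cartan_exp :: "nat \<Rightarrow> nat \<Rightarrow> nat \<Rightarrow> int" where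
  "cartan_exp n r s = 2 * int r * int s - (int n - 1) * (int r + int s + 1)"

definition R_matrix :: "nat \<Rightarrow> nat \<Rightarrow> nat \<Rightarrow> nat \<Rightarrow> nat \<Rightarrow> laurent" where
  "R_matrix n i j r s =
     (\<Sum>k<n. var_pow (cartan_exp n r s) * var_pow (int (k * (k - 1) div 2)) *
       (var_pow 1 - var_pow (-1)) ^ k * E_pow n k i r * F_divpow n k j s)"

definition R_inverse :: "nat \<Rightarrow> nat \<Rightarrow> nat \<Rightarrow> nat \<Rightarrow> nat \<Rightarrow> laurent" where
  "R_inverse n i j r s =
     (\<Sum>k<n. (-1) ^ k * var_pow (- int (k * (k - 1) div 2)) *
       (var_pow 1 - var_pow (-1)) ^ k * E_pow n k i r * F_divpow n k j s *
       var_pow (- cartan_exp n i j))"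

text \<open>
  The endomorphism of \<open>V\<^sub>n \<otimes> V\<^sub>n\<close> attached to a crossing. With \<open>P\<close> the flip of the two tensor
  factors, a negative crossing acts by \<open>P R\<close> and a positive one by its inverse \<open>R\<^bsup>-1\<^esup> P\<close>. With
  this choice \<open>q\<close> is the variable of Jones: the right-handed trefoil has
  \<open>J\<^sub>2 = q + q\<^sup>3 - q\<^sup>4\<close>. (The other choice amounts to replacing \<open>q\<close> by its inverse.)
\<close>

definition crossing :: "nat \<Rightarrow> bool \<Rightarrow> nat \<Rightarrow> nat \<Rightarrow> nat \<Rightarrow> nat \<Rightarrow> laurent" where
  "crossing n \<epsilon> i j r s =
     (if \<epsilon> then R_inverse n j i r s else R_matrix n i j s r)"


section \<open>Braids and the colored Jones polynomial of a closed braid\<close>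

text \<open>
  A letter \<open>(i, True)\<close> is the positive generator that exchanges the neighbouring strands \<open>i\<close> and
  \<open>i + 1\<close> (counted from \<open>0\<close>), and \<open>(i, False)\<close> is its inverse.
\<close>

type_synonym braid_word = "(nat \<times> bool) list"

definition braid_perm :: "braid_word \<Rightarrow> nat \<Rightarrow> nat" where
  "braid_perm w = fold (\<lambda>(i, \<epsilon>) \<pi>. Transposition.transpose i (Suc i) \<circ> \<pi>) w id"

text \<open>The braids, with their number of strands, whose closure is connected.\<close>

typedef knot_braid =
  "{(m, w :: braid_word). 0 < m \<and> (\<forall>(i, \<epsilon>)\<in>set w. Suc i < m) \<and>
      (\<forall>p<m. \<exists>k. (braid_perm w ^^ k) 0 = p)}"
  by (rule exI[of _ "(1, [])"]) (auto intro: exI[of _ "0 :: nat"])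

text \<open>
  Basis vectors of the \<open>m\<close>-th tensor power of \<open>V\<^sub>n\<close> are lists of \<open>m\<close> indices below \<open>n\<close>;
  \<open>braid_op n m w x y\<close> is the coefficient of \<open>y\<close> in the image of \<open>x\<close> (the first letter of the
  word is applied first).
\<close>

definition basis :: "nat \<Rightarrow> nat \<Rightarrow> nat list set" where
  "basis n m = {x. length x = m \<and> set x \<subseteq> {..<n}}"

definition letter_op :: "nat \<Rightarrow> nat \<times> bool \<Rightarrow> nat list \<Rightarrow> nat list \<Rightarrow> laurent" where
  "letter_op n = (\<lambda>(i, \<epsilon>) x y.
     if y = x[i := y ! i, Suc i := y ! Suc i]
     then crossing n \<epsilon> (x ! i) (x ! Suc i) (y ! i) (y ! Suc i) else 0)"

fun braid_op :: "nat \<Rightarrow> nat \<Rightarrow> braid_word \<Rightarrow> nat list \<Rightarrow> nat list \<Rightarrow> laurent" where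
  "braid_op n m [] x y = (if x = y then 1 else 0)"
| "braid_op n m (g # w) x y = (\<Sum>z\<in>basis n m. letter_op n g x z * braid_op n m w z y)"

text \<open>
  The quantum invariant of the closed braid is the quantum trace, i.e. the trace after composition
  with \<open>K \<otimes> \<dots> \<otimes> K\<close>. (No correction by the writhe occurs, because of the normalization of \<open>R\<close>.)
\<close>

definition quantum_trace :: "nat \<Rightarrow> nat \<Rightarrow> braid_word \<Rightarrow> laurent" where
  "quantum_trace n m w = (\<Sum>x\<in>basis n m. braid_op n m w x x * (\<Prod>p<m. K_weight n (x ! p)))"

text \<open>
  Normalization: divide by the value at the unknot, which is the closure of the
  trivial braid with one strand. The quotient is a Laurent polynomial in \<open>q = v\<^sup>2\<close>.
\<close>

definition closed_braid_jones :: "knot_braid \<Rightarrow> nat \<Rightarrow> laurent" where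
  "closed_braid_jones b n = (case Rep_knot_braid b of (m, w) \<Rightarrow>
     (THE P. subst_square P * quantum_trace n 1 [] = quantum_trace n m w))"


section \<open>Knots in the three-sphere\<close>

abbreviation S3 :: "(complex \<times> complex) set" where
  "S3 \<equiv> sphere 0 1"

definition ambient_isotopic :: "(complex \<times> complex) set \<Rightarrow> (complex \<times> complex) set \<Rightarrow> bool" where
  "ambient_isotopic K L \<longleftrightarrow> K \<subseteq> S3 \<and>
     (\<exists>H :: real \<times> (complex \<times> complex) \<Rightarrow> complex \<times> complex.
        continuous_on ({0..1} \<times> S3) H \<and>
        (\<forall>t\<in>{0..1}. \<exists>G. homeomorphism S3 S3 (\<lambda>x. H (t, x)) G) \<and>
        (\<forall>x\<in>S3. H (0, x) = x) \<and>
        (\<lambda>x. H (1, x)) ` K = L)"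

definition smooth_knot :: "(complex \<times> complex) set \<Rightarrow> bool" where
  "smooth_knot K \<longleftrightarrow>
     (\<exists>\<gamma> :: real \<Rightarrow> complex \<times> complex.
        \<gamma> C1_differentiable_on UNIV \<and> (\<forall>t. vector_derivative \<gamma> (at t) \<noteq> 0) \<and>
        (\<forall>t. \<gamma> (t + 1) = \<gamma> t) \<and> inj_on \<gamma> {0..<1} \<and>
        range \<gamma> = K \<and> K \<subseteq> S3)"

text \<open>Knots are tame, as usual (wild knots have no diagrams and no colored Jones polynomial). They
  are unoriented, since the invariant does not depend on the orientation.\<close>

definition knot :: "(complex \<times> complex) set \<Rightarrow> bool" where
  "knot K \<longleftrightarrow> (\<exists>L. smooth_knot L \<and> ambient_isotopic L K)"

text \<open>
  The closed braid in \<open>S3\<close>. A geometric braid is a motion of \<open>m\<close> points in the open unit disc; here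
  the points rest on the real axis, and a letter \<open>(i, \<epsilon>)\<close> exchanges the points \<open>i\<close> and
  \<open>i + 1\<close> by a half-turn, counterclockwise if the letter is positive. After the last letter
  the points rest for one more unit of time, so that the empty word needs no special treatment.
  While this happens the angle of the first complex coordinate makes one turn. Counterclockwise
  half-turns are positive crossings for the orientation of \<open>S3\<close> as the boundary of the unit ball:
  for two strands and the word with three positive letters, the closure is the
  torus knot of the singularity \<open>z\<^sup>3 = w\<^sup>2\<close>, i.e. the right-handed trefoil.
\<close>

definition rest_point :: "nat \<Rightarrow> nat \<Rightarrow> complex" where
  "rest_point m p = of_real (real (p + 1) / real (m + 1))"

definition half_turn :: "nat \<Rightarrow> nat \<times> bool \<Rightarrow> real \<Rightarrow> complex set" where
  "half_turn m = (\<lambda>(i, \<epsilon>) \<tau>.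
     let c = (rest_point m i + rest_point m (Suc i)) / 2;
         d = (rest_point m (Suc i) - rest_point m i) / 2 * cis (if \<epsilon> then pi * \<tau> else - pi * \<tau>)
     in rest_point m ` ({..<m} - {i, Suc i}) \<union> {c - d, c + d})"

definition braid_points :: "nat \<Rightarrow> braid_word \<Rightarrow> real \<Rightarrow> complex set" where
  "braid_points m w t =
     (if nat \<lfloor>t\<rfloor> < length w then half_turn m (w ! nat \<lfloor>t\<rfloor>) (frac t) else rest_point m ` {..<m})"

definition braid_closure :: "knot_braid \<Rightarrow> (complex \<times> complex) set" where
  "braid_closure b = (case Rep_knot_braid b of (m, w) \<Rightarrow>
     {(of_real (sqrt (1 - (cmod u)\<^sup>2)) * cis (2 * pi * t / real (length w + 1)), u) | u t.
        t \<in> {0..real (length w + 1)} \<and> u \<in> braid_points m w t})"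

text \<open>
  \<open>colored_jones K n\<close> is the colored Jones polynomial of \<open>K\<close> for the color \<open>n \<ge> 1\<close>. By the theorem
  of Alexander every knot is isotopic to a closed braid, and the
  invariant does not depend on the chosen braid.
\<close>

definition colored_jones :: "(complex \<times> complex) set \<Rightarrow> nat \<Rightarrow> laurent" where
  "colored_jones K = closed_braid_jones (SOME b. ambient_isotopic K (braid_closure b))"

end

theory Submission
  imports Defs "HOL-Combinatorics.Cycles"
begin

text \<open>
  The operator of a braid commutes with \<open>E\<close>, so its partial trace over all strands but one is a scalar on
  \<open>V\<^sub>n\<close>. This scalar is the normalized invariant, and it can be read off with the index \<open>0\<close> on the
  open strand. Each state of the resulting state sum contributes a monomial in \<open>v\<close> and \<open>v\<^bsup>n-1\<^esup>\<close> times
  a factor \<open>1 - q\<^bsup>t+1-n\<^esup>\<close> whenever, at a crossing, the index of the over-strand drops from above \<open>t\<close> to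
  at most \<open>t\<close>; indices of under-strands never drop. Since the closure is connected, the open
  strand visits every index of the state and comes back to \<open>0\<close>. So a state with largest index \<open>M\<close>
  is divisible by \<open>(q\<^bsup>1-n\<^esup>;q)\<^sub>M\<close>, and for every \<open>M\<close> there are only finitely many such states. The functions
  \<open>\<Sum>\<^sub>k a\<^sub>k (X;q)\<^sub>k\<close> of \<open>X = q\<^bsup>1-n\<^esup>\<close> are stable under multiplication by \<open>X\<close> and \<open>X\<^bsup>-1\<^esup>\<close>.
  Only even powers of \<open>v\<close> occur: the R-matrix changes under \<open>v \<mapsto> -v\<close> by a gauge transformation,
  up to a sign that the parity of the cyclic permutation of the braid controls.
\<close>

section \<open>Laurent polynomials\<close>

lemma var_pow_0 [simp]: "var_pow 0 = 1"
  by (simp add: var_pow_def)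

lemma var_pow_add: "var_pow (a + b) = var_pow a * var_pow b"
  by (simp add: var_pow_def mult_single)

lemma var_pow_inject [simp]: "var_pow a = var_pow b \<longleftrightarrow> a = b"
  by (metis var_pow_def lookup_single_eq lookup_single_not_eq zero_neq_one)

lemma var_pow_sum: "var_pow (\<Sum>x\<in>A. f x) = (\<Prod>x\<in>A. var_pow (f x))"
  by (induction A rule: infinite_finite_induct) (simp_all add: var_pow_add)

lemma var_pow_power: "var_pow a ^ k = var_pow (int k * a)"
  by (induction k) (simp_all add: var_pow_add algebra_simps)

lemma lookup_subst_square:
  "Poly_Mapping.lookup (subst_square P) k = (if even k then Poly_Mapping.lookup P (k div 2) else 0)"
proof -
  have "Poly_Mapping.lookup (subst_square P) k
      = (\<Sum>j\<in>Poly_Mapping.keys P. if k div 2 = j then (if even k then Poly_Mapping.lookup P j else 0) else 0)"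
    unfolding subst_square_def lookup_sum
    by (rule sum.cong) (auto simp: lookup_single when_def)
  then show ?thesis
    by (simp add: sum.delta in_keys_iff)
qed

text \<open>Needed for uniqueness of the quotient in \<open>closed_braid_jones\<close>, which is
  defined by a definite description.\<close>

lemma subst_square_inject: "subst_square P = subst_square Q \<Longrightarrow> P = Q"
proof (rule poly_mapping_eqI)
  fix k assume "subst_square P = subst_square Q"
  then have "Poly_Mapping.lookup (subst_square P) (2 * k) = Poly_Mapping.lookup (subst_square Q) (2 * k)" by simp
  then show "Poly_Mapping.lookup P k = Poly_Mapping.lookup Q k" by (simp add: lookup_subst_square)
qed

lemma subst_square_single: "subst_square (Poly_Mapping.single k c) = Poly_Mapping.single (2 * k) c"
  by (rule poly_mapping_eqI) (auto simp: lookup_subst_square lookup_single when_def elim!: oddE)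

lemma subst_square_var_pow: "subst_square (var_pow k) = var_pow (2 * k)"
  by (simp add: var_pow_def subst_square_single)

lemma subst_square_0 [simp]: "subst_square 0 = 0"
  by (rule poly_mapping_eqI) (simp add: lookup_subst_square)

lemma subst_square_1 [simp]: "subst_square 1 = 1"
  using subst_square_var_pow[of 0] by simp

lemma subst_square_add: "subst_square (P + Q) = subst_square P + subst_square Q"
  by (rule poly_mapping_eqI) (simp add: lookup_subst_square lookup_add)

lemma subst_square_uminus: "subst_square (- P) = - subst_square P"
  by (rule poly_mapping_eqI) (simp add: lookup_subst_square)

lemma subst_square_diff: "subst_square (P - Q) = subst_square P - subst_square Q"
  by (rule poly_mapping_eqI) (simp add: lookup_subst_square lookup_minus)

lemma subst_square_sum: "subst_square (\<Sum>x\<in>A. f x) = (\<Sum>x\<in>A. subst_square (f x))"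
  by (induction A rule: infinite_finite_induct) (simp_all add: subst_square_add)

lemma sum_singles: "P = (\<Sum>k\<in>Poly_Mapping.keys P. Poly_Mapping.single k (Poly_Mapping.lookup P k))"
proof (rule poly_mapping_eqI)
  fix j
  have "(\<Sum>k\<in>Poly_Mapping.keys P. Poly_Mapping.lookup (Poly_Mapping.single k (Poly_Mapping.lookup P k)) j)
      = (\<Sum>k\<in>Poly_Mapping.keys P. if j = k then Poly_Mapping.lookup P k else 0)"
    by (auto simp: lookup_single when_def intro!: sum.cong)
  then show "Poly_Mapping.lookup P j = Poly_Mapping.lookup (\<Sum>k\<in>Poly_Mapping.keys P. Poly_Mapping.single k (Poly_Mapping.lookup P k)) j"
    by (simp add: lookup_sum sum.delta in_keys_iff)
qed

text \<open>Both sides are biadditive, so expanding \<open>P\<close> and \<open>Q\<close> into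
  monomials reduces the claim to products of two \<open>single\<close>s.\<close>

lemma subst_square_mult: "subst_square (P * Q) = subst_square P * subst_square Q"
proof -
  have "subst_square (P * Q) = subst_square
      ((\<Sum>k\<in>Poly_Mapping.keys P. Poly_Mapping.single k (Poly_Mapping.lookup P k)) * (\<Sum>k\<in>Poly_Mapping.keys Q. Poly_Mapping.single k (Poly_Mapping.lookup Q k)))"
    by (simp flip: sum_singles)
  also have "\<dots> = (\<Sum>k\<in>Poly_Mapping.keys P. Poly_Mapping.single (2 * k) (Poly_Mapping.lookup P k))
      * (\<Sum>k\<in>Poly_Mapping.keys Q. Poly_Mapping.single (2 * k) (Poly_Mapping.lookup Q k))"
    by (simp add: sum_product subst_square_sum mult_single subst_square_single distrib_left)
  also have "\<dots> = subst_square P * subst_square Q"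
    by (simp only: subst_square_def)
  finally show ?thesis .
qed

lemma subst_square_power: "subst_square (P ^ k) = subst_square P ^ k"
  by (induction k) (simp_all add: subst_square_mult)

lemma subst_square_prod: "subst_square (\<Prod>x\<in>A. f x) = (\<Prod>x\<in>A. subst_square (f x))"
  by (induction A rule: infinite_finite_induct) (simp_all add: subst_square_mult)

section \<open>Quantum integers and quantum binomial coefficients\<close>

text \<open>This is v - v^(-1) times the quantum integer [a], for negative a too. The powers of v -
  v^(-1) in the R-matrix are absorbed into such factors, so that no division occurs.\<close>

definition qdiff :: "int \<Rightarrow> laurent" where
  "qdiff a = var_pow a - var_pow (- a)"

lemma qdiff_1: "var_pow 1 - var_pow (-1) = qdiff 1"
  by (simp add: qdiff_def)

lemma qint_Suc: "qint (Suc k) = var_pow (- int k) + var_pow 1 * qint k"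
proof -
  have "qint (Suc k) = var_pow (- int k) + (\<Sum>l<k. var_pow (int k - 2 * int l))"
    by (simp add: qint_def)
  also have "(\<Sum>l<k. var_pow (int k - 2 * int l)) = var_pow 1 * qint k"
    by (simp add: qint_def sum_distrib_left flip: var_pow_add)
  finally show ?thesis .
qed

lemma qdiff_1_qint: "qdiff 1 * qint k = qdiff (int k)"
proof (induction k)
  case 0
  then show ?case by (simp add: qint_def qdiff_def)
next
  case (Suc k)
  have "qdiff 1 * qint (Suc k) = qdiff 1 * var_pow (- int k) + var_pow 1 * (qdiff 1 * qint k)"
    by (simp add: qint_Suc algebra_simps)
  also have "\<dots> = qdiff (int (Suc k))"
    unfolding Suc.IH by (simp add: qdiff_def algebra_simps flip: var_pow_add)
  finally show ?case .
qed

lemma qint_nonzero: "0 < k \<Longrightarrow> qint k \<noteq> 0"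
  using qdiff_1_qint[of k] by (auto simp: qdiff_def)

text \<open>A monomial times a polynomial in q^(-1) or q. For a = n - 1 - t the second factor is 1 -
  q^(t+1-n), the source of all Pochhammer factors.\<close>

lemma qdiff_eq: "qdiff a = var_pow a * subst_square (1 - var_pow (- a))"
  by (simp add: qdiff_def subst_square_diff subst_square_var_pow algebra_simps flip: var_pow_add)

lemma qbinom_eq_0: "m < k \<Longrightarrow> qbinom m k = 0"
  by (induction m k rule: qbinom.induct) auto

text \<open>The quantum Pascal rule that the bar involution, which inverts the variable, makes out of the
  defining one.\<close>

lemma qbinom_Suc_Suc_bar:
  "qbinom (Suc m) (Suc k) =
     var_pow (- int k - 1) * qbinom m (Suc k) + var_pow (int m - int k) * qbinom m k"
proof (induction m arbitrary: k)
  case 0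
  then show ?case by (cases k) simp_all
next
  case (Suc m)
  note IH = Suc.IH
  have vp: "var_pow a * (var_pow b * z) = var_pow (a + b) * z" for a b z
    by (simp add: var_pow_add mult.assoc)
  show ?case
  proof (cases k)
    case 0
    have "qbinom (Suc (Suc m)) (Suc 0) = var_pow 1 * (var_pow (- 1) * qbinom m (Suc 0) + var_pow (int m))
        + var_pow (- int (Suc m))"
      using IH[of 0] by simp
    also have "\<dots> = var_pow (- 1) * (var_pow 1 * qbinom m (Suc 0) + var_pow (- int m)) + var_pow (int (Suc m))"
      by (simp add: vp distrib_left algebra_simps flip: var_pow_add)
    finally show ?thesis unfolding 0 by simp
  next
    case k: (Suc l)
    have "qbinom (Suc (Suc m)) (Suc k) = var_pow (int k + 1) * qbinom (Suc m) (Suc k)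
        + var_pow (int k - int (Suc m)) * qbinom (Suc m) (Suc l)"
      unfolding k by (rule qbinom.simps(3))
    also have "\<dots> = var_pow (int k + 1) * (var_pow (- int k - 1) * qbinom m (Suc k) + var_pow (int m - int k) * qbinom m k)
        + var_pow (int k - int (Suc m)) * (var_pow (- int l - 1) * qbinom m (Suc l) + var_pow (int m - int l) * qbinom m l)"
      unfolding IH ..
    \<comment> \<open>Since \<open>k = Suc l\<close>, two of the four terms contain
      \<open>qbinom m k\<close>, with coefficients v^(m+1) and v^(-m-1). They trade places, and the
      new pairs are instances of the defining rule.\<close>
    also have "\<dots> = var_pow (- int k - 1) * (var_pow (int k + 1) * qbinom m (Suc k) + var_pow (int k - int m) * qbinom m k)
        + var_pow (int (Suc m) - int k) * (var_pow (int l + 1) * qbinom m (Suc l) + var_pow (int l - int m) * qbinom m l)"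
      unfolding k by (simp add: vp distrib_left algebra_simps flip: var_pow_add)
    also have "\<dots> = var_pow (- int k - 1) * qbinom (Suc m) (Suc k)
        + var_pow (int (Suc m) - int k) * qbinom (Suc m) k"
      unfolding k by simp
    finally show ?thesis .
  qed
qed

text \<open>All exponents of v in a balanced binomial have the same parity, that of j k. Splitting
  off one monomial leaves a Laurent polynomial in q; the parity is followed through the whole state
  sum.\<close>

lemma qbinom_even: "\<exists>c. qbinom (j + k) k = var_pow (int (j * k)) * subst_square c"
proof -
  have "k \<le> m \<Longrightarrow> \<exists>c. qbinom m k = var_pow (int ((m - k) * k)) * subst_square c" for m
  proof (induction m k rule: qbinom.induct)
    case (1 m)
    show ?case by (rule exI[of _ 1]) simp
  next
    case (3 m k)
    then obtain d where d: "qbinom m k = var_pow (int ((m - k) * k)) * subst_square d" by auto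
    have "\<exists>c. qbinom m (Suc k) = var_pow (int ((m - Suc k) * Suc k)) * subst_square c"
    proof (cases "Suc k \<le> m")
      case False
      then show ?thesis by (intro exI[of _ 0]) (simp add: qbinom_eq_0)
    qed (use 3 in auto)
    then obtain c where c: "qbinom m (Suc k) = var_pow (int ((m - Suc k) * Suc k)) * subst_square c"
      by blast
    have "int ((m - k) * k) + (int k - int m) = int ((Suc m - Suc k) * Suc k) + 2 * (int k - int m)"
      using 3 by (auto simp: le_iff_add algebra_simps)
    then have 1: "var_pow (int k - int m) * qbinom m k
        = var_pow (int ((Suc m - Suc k) * Suc k)) * subst_square (var_pow (int k - int m) * d)"
      unfolding d subst_square_mult subst_square_var_pow
      by (metis (no_types, lifting) mult.assoc mult.commute var_pow_add)
    \<comment> \<open>For \<open>m = k\<close> the truncated difference \<open>m - Suc k\<close>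
      breaks the identity of exponents, but there the binomial is 0 and so is
      \<open>subst_square c\<close>.\<close>
    have 2: "var_pow (int k + 1) * qbinom m (Suc k) = var_pow (int ((Suc m - Suc k) * Suc k)) * subst_square c"
    proof (cases "Suc k \<le> m")
      case False
      then have "qbinom m (Suc k) = 0" by (simp add: qbinom_eq_0)
      then have "subst_square c = 0" using c
        by (metis mult_eq_0_iff subst_square_0 var_pow_0 var_pow_add right_minus mult_cancel_left one_neq_zero mult.commute)
      then show ?thesis using \<open>qbinom m (Suc k) = 0\<close> by simp
    next
      case True
      then obtain l where "m = Suc k + l" using le_iff_add by blast
      then have "int k + 1 + int ((m - Suc k) * Suc k) = int ((Suc m - Suc k) * Suc k)"
        by (simp add: algebra_simps)
      then show ?thesis unfolding c by (metis mult.assoc var_pow_add)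
    qed
    show ?case
      unfolding qbinom.simps(3) 1 2 by (metis distrib_left subst_square_add)
  qed simp
  from this[of "j + k"] show ?thesis by simp
qed

section \<open>The braid action commutes with E\<close>

lemma cartan_exp_Suc_left:
  "cartan_exp n (Suc r) s = cartan_exp n r s - (int n - 1 - 2 * int s)"
  and cartan_exp_Suc_right:
  "cartan_exp n r (Suc s) = cartan_exp n r s - (int n - 1 - 2 * int r)"
  by (simp_all add: cartan_exp_def algebra_simps)

text \<open>For x = n this is the coefficient form of [E, F^(k+1)/[k+1]!] e_j = [n-1-2j-k] F^k/[k]!
  e_j, multiplied by v - v^(-1). In the first product on the right the defining Pascal rule is used
  for the positive half of \<open>qdiff\<close> and its bar conjugate for the negative half.\<close>

lemma qbinom_commutator:
  "qdiff (x - 2 * int j - int k - 1) * qbinom (j + k) k =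
     qdiff (x - int j - int k - 1) * qbinom (Suc (j + k)) (Suc k) - qdiff (x - int j) * qbinom (j + k) (Suc k)"
proof -
  let ?b = "qbinom (j + k) k" and ?c = "qbinom (j + k) (Suc k)"
  have vp: "var_pow a * (var_pow b * z) = var_pow (a + b) * z" for a b z
    by (simp add: var_pow_add mult.assoc)
  have "qdiff (x - int j - int k - 1) * qbinom (Suc (j + k)) (Suc k)
      = var_pow (x - int j - int k - 1) * qbinom (Suc (j + k)) (Suc k)
        - var_pow (1 + int j + int k - x) * qbinom (Suc (j + k)) (Suc k)"
    by (simp add: qdiff_def algebra_simps)
  also have "\<dots> = var_pow (x - int j - int k - 1) * (var_pow (int k + 1) * ?c + var_pow (int k - int (j + k)) * ?b)
        - var_pow (1 + int j + int k - x) * (var_pow (- int k - 1) * ?c + var_pow (int (j + k) - int k) * ?b)"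
    using qbinom.simps(3)[of "j + k" k] qbinom_Suc_Suc_bar[of "j + k" k] by metis
  also have "\<dots> = qdiff (x - 2 * int j - int k - 1) * ?b + qdiff (x - int j) * ?c"
    by (simp only: qdiff_def distrib_left left_diff_distrib right_diff_distrib vp) (simp add: algebra_simps)
  finally show ?thesis by simp
qed

text \<open>The quasi-R-matrix \<open>\<Theta>\<close> for \<open>\<delta> = 1\<close> and its inverse, which is its bar conjugate, for \<open>\<delta> = -1\<close>.\<close>

definition theta :: "nat \<Rightarrow> int \<Rightarrow> nat \<Rightarrow> nat \<Rightarrow> nat \<Rightarrow> nat \<Rightarrow> laurent" where
  "theta n \<delta> i j r s = (if r \<le> i \<and> r + s = i + j then
     of_int \<delta> ^ (i - r) * var_pow (\<delta> * int ((i - r) * (i - r - 1) div 2)) *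
     (\<Prod>l<i - r. qdiff (int (n - i + l))) * qbinom s (i - r) else 0)"

lemma prod_qdiff: "qdiff 1 ^ k * (\<Prod>l<k. qint (a l)) = (\<Prod>l<k. qdiff (int (a l)))"
  by (induction k) (simp_all flip: qdiff_1_qint)

text \<open>\<open>E_pow\<close> leaves only the term \<open>k = i - r\<close>. For
  \<open>i < r\<close> this truncated index is 0 and its term vanishes too, as does
  \<open>theta\<close>.\<close>

lemma R_matrix_theta:
  assumes "i < n" "s < n"
  shows "R_matrix n i j r s = var_pow (cartan_exp n r s) * theta n 1 i j r s"
proof -
  let ?f = "\<lambda>k. var_pow (cartan_exp n r s) * var_pow (int (k * (k - 1) div 2)) *
       (var_pow 1 - var_pow (-1)) ^ k * E_pow n k i r * F_divpow n k j s"
  have "R_matrix n i j r s = (\<Sum>k<n. if k = i - r then ?f (i - r) else 0)"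
    unfolding R_matrix_def by (rule sum.cong) (auto simp: E_pow_def)
  also have "\<dots> = ?f (i - r)"
    using assms by (subst sum.delta) auto
  also have "\<dots> = var_pow (cartan_exp n r s) * theta n 1 i j r s"
    unfolding theta_def prod_qdiff[symmetric] qdiff_1
    using assms by (auto simp: E_pow_def F_divpow_def mult_ac)
  finally show ?thesis .
qed

lemma R_inverse_theta:
  assumes "i < n" "s < n"
  shows "R_inverse n i j r s = theta n (-1) i j r s * var_pow (- cartan_exp n i j)"
proof -
  let ?f = "\<lambda>k. (-1) ^ k * var_pow (- int (k * (k - 1) div 2)) *
       (var_pow 1 - var_pow (-1)) ^ k * E_pow n k i r * F_divpow n k j s *
       var_pow (- cartan_exp n i j)"
  have "R_inverse n i j r s = (\<Sum>k<n. if k = i - r then ?f (i - r) else 0)"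
    unfolding R_inverse_def by (rule sum.cong) (auto simp: E_pow_def)
  also have "\<dots> = ?f (i - r)"
    using assms by (subst sum.delta) auto
  also have "\<dots> = theta n (-1) i j r s * var_pow (- cartan_exp n i j)"
    unfolding theta_def prod_qdiff[symmetric] qdiff_1
    using assms by (auto simp: E_pow_def F_divpow_def mult_ac)
  finally show ?thesis .
qed

text \<open>\<open>\<Theta> (E \<otimes> K\<^bsup>\<delta>\<^esup> + 1 \<otimes> E) = (E \<otimes> K\<^bsup>-\<delta>\<^esup> + 1 \<otimes> E) \<Theta>\<close>, by matrix coefficients.\<close>

lemma theta_E:
  assumes \<delta>: "\<delta> = 1 \<or> \<delta> = -1" and n: "i < n" "j < n" "s < n"
  shows "(if 0 < i then qint (n - i) * var_pow (\<delta> * (int n - 1 - 2 * int j)) * theta n \<delta> (i - 1) j r s else 0)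
      + (if 0 < j then qint (n - j) * theta n \<delta> i (j - 1) r s else 0)
    = theta n \<delta> i j (Suc r) s * qint (n - Suc r) * var_pow (- \<delta> * (int n - 1 - 2 * int s))
      + theta n \<delta> i j r (Suc s) * qint (n - Suc s)"
    (is "?t1 + ?t2 = ?t3 + ?t4")
proof (cases "r < i \<and> Suc (r + s) = i + j")
  case False
  \<comment> \<open>For \<open>r = i\<close> only the action of 1 \<otimes> E survives, with
    coefficient [n - j] on both sides. Otherwise all four terms violate the support condition of
    \<open>theta\<close>.\<close>
  show ?thesis
  proof (cases "r = i \<and> Suc s = j")
    case True
    then show ?thesis by (auto simp: theta_def)
  next
    case False': False
    have "?t1 = 0" "?t2 = 0" "?t3 = 0" "?t4 = 0" using False False' by (auto simp: theta_def)
    then show ?thesis by (simp only:)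
  qed
next
  case True
  define k where "k = i - Suc r"
  have i: "i = Suc (r + k)" and s: "s = j + k" using True by (auto simp: k_def)
  define x where "x = int n"
  define P where "P = (\<Prod>l<Suc k. qdiff (int (n - i + l)))"
  define c where "c = of_int \<delta> ^ k * var_pow (\<delta> * int (k * (k - 1) div 2))"
  have c: "of_int \<delta> ^ Suc k * var_pow (\<delta> * int (Suc k * (Suc k - 1) div 2)) = c * of_int \<delta> * var_pow (\<delta> * int k)"
  proof -
    have "Suc k * (Suc k - 1) div 2 = k * (k - 1) div 2 + k"
      by (cases k) (simp_all add: algebra_simps)
    then show ?thesis by (simp add: c_def algebra_simps var_pow_add)
  qed
  have P_first: "P = qdiff (int (n - i)) * (\<Prod>l<k. qdiff (int (n - (i - 1) + l)))"
  proof -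
    have "n - (i - 1) + l = n - i + Suc l" for l using n i by simp
    then show ?thesis unfolding P_def by (simp only: prod.lessThan_Suc_shift) simp
  qed
  have P_last: "P = (\<Prod>l<k. qdiff (int (n - i + l))) * qdiff (int (n - Suc r))"
  proof -
    have "n - i + k = n - Suc r" using n i by simp
    then show ?thesis unfolding P_def prod.lessThan_Suc by (simp only:)
  qed
  \<comment> \<open>The factor \<open>qdiff 1\<close> turns every quantum integer into a
    \<open>qdiff\<close>, after which all four terms share \<open>c * P\<close>. It is cancelled at
    the end.\<close>
  have t1: "qdiff 1 * ?t1 = c * P * (var_pow (\<delta> * (x - 1 - 2 * int j)) * qbinom (j + k) k)"
    unfolding P_first using i s by (simp add: theta_def c_def x_def mult_ac flip: qdiff_1_qint)
  have t2: "qdiff 1 * ?t2 = c * P * (of_int \<delta> * var_pow (\<delta> * int k) * qdiff (x - int j) * qbinom (j + k) (Suc k))"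
  proof (cases "0 < j")
    case True
    then have "theta n \<delta> i (j - 1) r s = c * of_int \<delta> * var_pow (\<delta> * int k) * P * qbinom (j + k) (Suc k)"
      using i s c by (simp add: theta_def P_def)
    moreover have "qdiff (x - int j) = qdiff 1 * qint (n - j)"
      using n by (simp add: qdiff_1_qint x_def of_nat_diff)
    ultimately show ?thesis using True by (simp add: mult_ac)
  qed (simp add: qbinom_eq_0)
  have t3: "qdiff 1 * ?t3 = c * P * (var_pow (- \<delta> * (x - 1 - 2 * int (j + k))) * qbinom (j + k) k)"
    unfolding P_last using i s by (simp add: theta_def c_def x_def mult_ac flip: qdiff_1_qint)
  have t4: "qdiff 1 * ?t4 = c * P * (of_int \<delta> * var_pow (\<delta> * int k) * qdiff (x - int j - int k - 1) * qbinom (Suc (j + k)) (Suc k))"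
  proof -
    have "theta n \<delta> i j r (Suc s) = c * of_int \<delta> * var_pow (\<delta> * int k) * P * qbinom (Suc (j + k)) (Suc k)"
      using i s c by (simp add: theta_def P_def)
    moreover have "x - int j - int k - 1 = int (n - Suc s)"
      using n s by (simp add: x_def of_nat_diff)
    then have "qdiff (x - int j - int k - 1) = qdiff 1 * qint (n - Suc s)"
      by (simp add: qdiff_1_qint)
    ultimately show ?thesis by (simp add: mult_ac)
  qed
  \<comment> \<open>The two terms with a power of K combine to the left side of
    \<open>qbinom_commutator\<close>.\<close>
  have D: "var_pow (\<delta> * (x - 1 - 2 * int j)) - var_pow (- \<delta> * (x - 1 - 2 * int (j + k)))
      = of_int \<delta> * var_pow (\<delta> * int k) * qdiff (x - 2 * int j - int k - 1)"
    using \<delta> by (auto simp: qdiff_def algebra_simps simp flip: var_pow_add)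
  have "qdiff 1 * ?t1 - qdiff 1 * ?t3 = qdiff 1 * ?t4 - qdiff 1 * ?t2"
  proof -
    have "qdiff 1 * ?t1 - qdiff 1 * ?t3 = c * P * ((var_pow (\<delta> * (x - 1 - 2 * int j)) - var_pow (- \<delta> * (x - 1 - 2 * int (j + k)))) * qbinom (j + k) k)"
      unfolding t1 t3 by (simp only: left_diff_distrib right_diff_distrib)
    also have "\<dots> = c * P * (of_int \<delta> * var_pow (\<delta> * int k) * (qdiff (x - 2 * int j - int k - 1) * qbinom (j + k) k))"
      unfolding D by (simp only: mult.assoc)
    also have "\<dots> = qdiff 1 * ?t4 - qdiff 1 * ?t2"
      unfolding t2 t4 qbinom_commutator by (simp only: right_diff_distrib mult.assoc)
    finally show ?thesis .
  qed
  moreover have "u + v = w + z" if "qdiff 1 * u - qdiff 1 * w = qdiff 1 * z - qdiff 1 * v" for u v w z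
  proof -
    have "qdiff 1 * (u + v) = qdiff 1 * (w + z)" using that by (simp add: algebra_simps)
    then show ?thesis by (simp add: qdiff_def)
  qed
  ultimately show ?thesis by blast
qed

text \<open>Moving E past the Cartan part shifts \<open>cartan_exp\<close> by a weight. This turns
  the twisted coproducts of \<open>theta_E\<close> into E \<otimes> K + 1 \<otimes> E and its flip;
  the sign \<delta> is -1 for a positive crossing and 1 for a negative one.\<close>

lemma crossing_E:
  assumes n: "a < n" "a' < n" "b < n" "b' < n"
  shows "(if 0 < a then qint (n - a) * K_weight n a' * crossing n \<epsilon> (a - 1) a' b b' else 0)
      + (if 0 < a' then qint (n - a') * crossing n \<epsilon> a (a' - 1) b b' else 0)
    = (if Suc b < n then crossing n \<epsilon> a a' (Suc b) b' * qint (n - Suc b) * K_weight n b' else 0)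
      + (if Suc b' < n then crossing n \<epsilon> a a' b (Suc b') * qint (n - Suc b') else 0)"
    (is "?t1 + ?t2 = ?t3 + ?t4")
proof (cases \<epsilon>)
  case True
  let ?D = "var_pow (- cartan_exp n a' a)"
  have 1: "?t1 = ?D * (if 0 < a then qint (n - a) * theta n (-1) a' (a - 1) b b' else 0)"
  proof (cases a)
    case (Suc x)
    have "K_weight n a' * var_pow (- cartan_exp n a' x) = ?D"
      by (simp add: Suc cartan_exp_Suc_right K_weight_def flip: var_pow_add)
    then show ?thesis using True Suc n by (simp add: crossing_def R_inverse_theta mult_ac)
  qed simp
  have 2: "?t2 = ?D * (if 0 < a' then qint (n - a') * var_pow (- 1 * (int n - 1 - 2 * int a)) * theta n (-1) (a' - 1) a b b' else 0)"
  proof (cases a')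
    case (Suc x)
    have "var_pow (- cartan_exp n x a) = ?D * var_pow (- 1 * (int n - 1 - 2 * int a))"
      by (simp add: Suc cartan_exp_Suc_left flip: var_pow_add)
    then show ?thesis using True Suc n by (simp add: crossing_def R_inverse_theta mult_ac)
  qed simp
  have 3: "?t3 = ?D * (theta n (-1) a' a (Suc b) b' * qint (n - Suc b) * var_pow (- (-1) * (int n - 1 - 2 * int b')))"
  proof (cases "Suc b < n")
    \<comment> \<open>At the top index the bound \<open>Suc b < n\<close> agrees with the vanishing
      of [0].\<close>
    case False
    then have "n - Suc b = 0" by simp
    then show ?thesis using False by (simp add: qint_def)
  qed (use True n in \<open>simp add: crossing_def R_inverse_theta K_weight_def mult_ac\<close>)
  have 4: "?t4 = ?D * (theta n (-1) a' a b (Suc b') * qint (n - Suc b'))"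
  proof (cases "Suc b' < n")
    case False
    then have "n - Suc b' = 0" by simp
    then show ?thesis using False by (simp add: qint_def)
  qed (use True n in \<open>simp add: crossing_def R_inverse_theta K_weight_def mult_ac\<close>)
  show ?thesis
    unfolding 1 2 3 4 using theta_E[of "-1" a' n a b' b] n
    by (simp only: distrib_left[symmetric] add.commute) simp
next
  case False
  let ?D = "var_pow (cartan_exp n b' b)"
  have 1: "?t1 = ?D * (if 0 < a then qint (n - a) * var_pow (1 * (int n - 1 - 2 * int a')) * theta n 1 (a - 1) a' b' b else 0)"
    using False n by (simp add: crossing_def R_matrix_theta K_weight_def mult_ac)
  have 2: "?t2 = ?D * (if 0 < a' then qint (n - a') * theta n 1 a (a' - 1) b' b else 0)"
    using False n by (simp add: crossing_def R_matrix_theta mult_ac)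
  have 3: "?t3 = ?D * (theta n 1 a a' b' (Suc b) * qint (n - Suc b))"
  proof (cases "Suc b < n")
    case False
    then have "n - Suc b = 0" by simp
    then show ?thesis using False by (simp add: qint_def)
  next
    case True
    have "var_pow (cartan_exp n b' (Suc b)) * K_weight n b' = ?D"
      by (simp add: cartan_exp_Suc_right K_weight_def flip: var_pow_add)
    then show ?thesis using True False n by (simp add: crossing_def R_matrix_theta mult_ac)
  qed
  have 4: "?t4 = ?D * (theta n 1 a a' (Suc b') b * qint (n - Suc b') * var_pow (- 1 * (int n - 1 - 2 * int b)))"
  proof (cases "Suc b' < n")
    case False
    then have "n - Suc b' = 0" by simp
    then show ?thesis using False by (simp add: qint_def)
  next
    case True
    have "var_pow (cartan_exp n (Suc b') b) = ?D * var_pow (- 1 * (int n - 1 - 2 * int b))"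
      by (simp add: cartan_exp_Suc_left flip: var_pow_add)
    then show ?thesis using True False n by (simp add: crossing_def R_matrix_theta mult_ac)
  qed
  show ?thesis
    unfolding 1 2 3 4 using theta_E[of 1 a n a' b b'] n
    by (simp only: distrib_left[symmetric] add.commute) simp
qed

section \<open>Tensor powers and the action of E on them\<close>

lemma finite_basis: "finite (basis n m)"
  using finite_lists_length_eq[of "{..<n}" m] by (simp add: basis_def conj_commute)

lemma basis_0 [simp]: "basis n 0 = {[]}"
  by (auto simp: basis_def)

lemma Cons_in_basis [simp]: "a # x \<in> basis n (Suc m) \<longleftrightarrow> a < n \<and> x \<in> basis n m"
  by (auto simp: basis_def)

lemma basis_length: "x \<in> basis n m \<Longrightarrow> length x = m"
  by (simp add: basis_def)

lemma basis_Suc: "basis n (Suc m) = (\<lambda>(a, x). a # x) ` ({..<n} \<times> basis n m)"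
proof (intro set_eqI iffI)
  fix x assume "x \<in> basis n (Suc m)"
  then show "x \<in> (\<lambda>(a, x). a # x) ` ({..<n} \<times> basis n m)"
    by (cases x) (auto simp: basis_def image_iff)
qed auto

lemma sum_basis_Suc: "(\<Sum>x\<in>basis n (Suc m). f x) = (\<Sum>a<n. \<Sum>x\<in>basis n m. f (a # x))"
proof -
  have "inj_on (\<lambda>(a, x). a # x) ({..<n} \<times> basis n m)" by (auto simp: inj_on_def)
  then show ?thesis
    unfolding basis_Suc sum.cartesian_product by (subst sum.reindex) (auto intro: sum.cong)
qed

definition K_list :: "nat \<Rightarrow> nat list \<Rightarrow> laurent" where
  "K_list n x = (\<Prod>a\<leftarrow>x. K_weight n a)"

lemma K_list_Cons [simp]: "K_list n (a # x) = K_weight n a * K_list n x"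
  by (simp add: K_list_def)

lemma K_list_nth: "K_list n x = (\<Prod>p<length x. K_weight n (x ! p))"
  by (simp add: K_list_def prod.list_conv_set_nth atLeast0LessThan)

lemma K_weight_mult: "a + b = c + d \<Longrightarrow> K_weight n a * K_weight n b = K_weight n c * K_weight n d"
  by (simp add: K_weight_def flip: var_pow_add)

text \<open>The action of \<open>E\<close> on tensor powers, for the coproduct \<open>E \<otimes> K + 1 \<otimes> E\<close>.\<close>

fun E_op :: "nat \<Rightarrow> nat list \<Rightarrow> nat list \<Rightarrow> laurent" where
  "E_op n (a # x) (b # y) =
     (if a = Suc b \<and> x = y then qint (n - a) * K_list n x else 0) + (if a = b then E_op n x y else 0)"
| "E_op n _ _ = 0"

lemma letter_op_Suc:
  "letter_op n (Suc i, \<epsilon>) (a # x) (b # y) = (if a = b then letter_op n (i, \<epsilon>) x y else 0)"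
  by (auto simp: letter_op_def)

lemma letter_op_0:
  "letter_op n (0, \<epsilon>) (a # a' # x) (b # b' # y) = (if x = y then crossing n \<epsilon> a a' b b' else 0)"
  by (auto simp: letter_op_def)

lemma crossing_weight: "crossing n \<epsilon> a a' b b' \<noteq> 0 \<Longrightarrow> a + a' = b + b'"
  by (auto simp: crossing_def R_matrix_def R_inverse_def E_pow_def F_divpow_def
      elim!: sum.not_neutral_contains_not_neutral split: if_splits)

text \<open>A crossing preserves the sum of its two indices. Hence letters commute with K, and for a
  given initial state only finitely many states can follow, whatever n is.\<close>

lemma letter_op_weight:
  assumes "letter_op n (i, \<epsilon>) x y \<noteq> 0" "Suc i < length x" "length y = length x"
  shows "sum_list x = sum_list y \<and> K_list n x = K_list n y"
  using assms
proof (induction i arbitrary: x y)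
  case 0
  then obtain l where "length x = Suc (Suc l)" "length y = Suc (Suc l)"
    by (auto simp: Suc_less_eq2 gr0_conv_Suc)
  then obtain a a' x' b b' y' where eq: "x = a # a' # x'" "y = b # b' # y'"
    by (auto simp: length_Suc_conv)
  with 0 have "x' = y'" and "a + a' = b + b'"
    by (auto simp: letter_op_0 split: if_splits dest: crossing_weight)
  then show ?case
    using K_weight_mult[of a a' b b' n] by (simp add: eq flip: mult.assoc add.assoc)
next
  case (Suc i)
  then obtain l where "length x = Suc l" "length y = Suc l"
    by (auto simp: Suc_less_eq2 gr0_conv_Suc)
  then obtain a x' b y' where eq: "x = a # x'" "y = b # y'"
    by (auto simp: length_Suc_conv)
  then show ?case using Suc.IH[of x' y'] Suc.prems
    by (auto simp: letter_op_Suc split: if_splits)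
qed


lemma sum_E_op_left:
  assumes "a < n"
  shows "(\<Sum>c<n. E_op n (a # x) (c # y) * f c)
       = (if 0 < a \<and> x = y then qint (n - a) * K_list n x * f (a - 1) else 0) + E_op n x y * f a"
proof -
  have "E_op n (a # x) (c # y) * f c = (if c = a - 1 then if 0 < a \<and> x = y then qint (n - a) * K_list n x * f c else 0 else 0)
      + (if c = a then E_op n x y * f c else 0)" for c
    by (auto simp: distrib_right)
  then show ?thesis
    using assms by (simp add: sum.distrib sum.delta less_imp_diff_less)
qed

lemma sum_E_op_right:
  assumes "b < n"
  shows "(\<Sum>c<n. f c * E_op n (c # x) (b # y))
       = (if Suc b < n \<and> x = y then f (Suc b) * (qint (n - Suc b) * K_list n x) else 0) + f b * E_op n x y"
proof -
  have "f c * E_op n (c # x) (b # y) = (if c = Suc b then if x = y then f c * (qint (n - Suc b) * K_list n x) else 0 else 0)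
      + (if c = b then f c * E_op n x y else 0)" for c
    by (auto simp: distrib_left)
  then show ?thesis
    using assms by (simp add: sum.distrib sum.delta)
qed

text \<open>Induction on the position of the crossing. At position 0, \<open>crossing_E\<close>
  treats the part of E that acts on the two crossing strands; the part on the other strands commutes
  because it acts on different factors.\<close>

lemma letter_op_E:
  assumes "Suc i < m" "x \<in> basis n m" "y \<in> basis n m"
  shows "(\<Sum>z\<in>basis n m. E_op n x z * letter_op n (i, \<epsilon>) z y)
       = (\<Sum>z\<in>basis n m. letter_op n (i, \<epsilon>) x z * E_op n z y)"
  using assms
proof (induction i arbitrary: m x y)
  case 0
  then obtain l where m: "m = Suc (Suc l)" by (auto simp: Suc_less_eq2 gr0_conv_Suc)
  obtain a a' x' b b' y' where eq: "x = a # a' # x'" "y = b # b' # y'"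
    using 0 unfolding m by (auto simp: basis_def length_Suc_conv)
  have n: "a < n" "a' < n" "b < n" "b' < n" "x' \<in> basis n l" "y' \<in> basis n l"
    using 0 by (auto simp: eq m)
  have fin: "finite (basis n l)" by (rule finite_basis)
  have L: "(\<Sum>z\<in>basis n m. E_op n x z * letter_op n (0, \<epsilon>) z y)
    = (if x' = y' then K_list n x' * ((if 0 < a then qint (n - a) * K_weight n a' * crossing n \<epsilon> (a - 1) a' b b' else 0)
      + (if 0 < a' then qint (n - a') * crossing n \<epsilon> a (a' - 1) b b' else 0)) else 0)
      + E_op n x' y' * crossing n \<epsilon> a a' b b'"
  proof -
    have "(\<Sum>z\<in>basis n m. E_op n x z * letter_op n (0, \<epsilon>) z y)
      = (\<Sum>c<n. \<Sum>c'<n. \<Sum>z\<in>basis n l. if z = y' then E_op n x (c # c' # z) * crossing n \<epsilon> c c' b b' else 0)"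
      unfolding m sum_basis_Suc eq letter_op_0 by (intro sum.cong refl) simp
    also have "\<dots> = (\<Sum>c<n. \<Sum>c'<n. E_op n x (c # c' # y') * crossing n \<epsilon> c c' b b')"
      using n fin by (simp add: sum.delta)
    also have "\<dots> = (\<Sum>c'<n. \<Sum>c<n. E_op n x (c # c' # y') * crossing n \<epsilon> c c' b b')"
      by (rule sum.swap)
    also have "\<dots> = (\<Sum>c'<n. if c' = a' then if 0 < a \<and> x' = y' then qint (n - a) * K_list n (a' # x') * crossing n \<epsilon> (a - 1) c' b b' else 0 else 0)
        + (\<Sum>c'<n. E_op n (a' # x') (c' # y') * crossing n \<epsilon> a c' b b')"
      unfolding eq sum_E_op_left[OF n(1)] sum.distrib by (intro arg_cong2[of _ _ _ _ "(+)"] sum.cong refl) auto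
    also have "\<dots> = (if 0 < a \<and> x' = y' then qint (n - a) * K_list n (a' # x') * crossing n \<epsilon> (a - 1) a' b b' else 0)
        + ((if 0 < a' \<and> x' = y' then qint (n - a') * K_list n x' * crossing n \<epsilon> a (a' - 1) b b' else 0)
        + E_op n x' y' * crossing n \<epsilon> a a' b b')"
      unfolding sum_E_op_left[OF n(2)] using n by (simp add: sum.delta)
    finally show ?thesis by (simp add: distrib_left mult_ac)
  qed
  have R: "(\<Sum>z\<in>basis n m. letter_op n (0, \<epsilon>) x z * E_op n z y)
    = (if x' = y' then K_list n x' * ((if Suc b < n then crossing n \<epsilon> a a' (Suc b) b' * qint (n - Suc b) * K_weight n b' else 0)
      + (if Suc b' < n then crossing n \<epsilon> a a' b (Suc b') * qint (n - Suc b') else 0)) else 0)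
      + E_op n x' y' * crossing n \<epsilon> a a' b b'"
  proof -
    have "(\<Sum>z\<in>basis n m. letter_op n (0, \<epsilon>) x z * E_op n z y)
      = (\<Sum>c<n. \<Sum>c'<n. \<Sum>z\<in>basis n l. if x' = z then crossing n \<epsilon> a a' c c' * E_op n (c # c' # z) y else 0)"
      unfolding m sum_basis_Suc eq letter_op_0 by (intro sum.cong refl) simp
    also have "\<dots> = (\<Sum>c<n. \<Sum>c'<n. crossing n \<epsilon> a a' c c' * E_op n (c # c' # x') y)"
      using n fin by (simp add: sum.delta')
    also have "\<dots> = (\<Sum>c'<n. \<Sum>c<n. crossing n \<epsilon> a a' c c' * E_op n (c # c' # x') y)"
      by (rule sum.swap)
    also have "\<dots> = (\<Sum>c'<n. if c' = b' then if Suc b < n \<and> x' = y' then crossing n \<epsilon> a a' (Suc b) c' * (qint (n - Suc b) * K_list n (b' # x')) else 0 else 0)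
        + (\<Sum>c'<n. crossing n \<epsilon> a a' b c' * E_op n (c' # x') (b' # y'))"
      unfolding eq sum_E_op_right[OF n(3)] sum.distrib by (intro arg_cong2[of _ _ _ _ "(+)"] sum.cong refl) auto
    also have "\<dots> = (if Suc b < n \<and> x' = y' then crossing n \<epsilon> a a' (Suc b) b' * (qint (n - Suc b) * K_list n (b' # x')) else 0)
        + ((if Suc b' < n \<and> x' = y' then crossing n \<epsilon> a a' b (Suc b') * (qint (n - Suc b') * K_list n x') else 0)
        + crossing n \<epsilon> a a' b b' * E_op n x' y')"
      unfolding sum_E_op_right[OF n(4)] using n by (simp add: sum.delta)
    finally show ?thesis by (simp add: distrib_left mult_ac)
  qed
  show ?case unfolding L R crossing_E[OF n(1-4)] ..
next
  case (Suc i)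
  then obtain l where m: "m = Suc l" by (auto simp: Suc_less_eq2)
  obtain a x' b y' where eq: "x = a # x'" "y = b # y'"
    using Suc.prems unfolding m by (auto simp: basis_def length_Suc_conv)
  have n: "a < n" "b < n" "x' \<in> basis n l" "y' \<in> basis n l"
    using Suc.prems by (auto simp: eq m)
  have fin: "finite (basis n l)" by (rule finite_basis)
  have L: "(\<Sum>z\<in>basis n m. E_op n x z * letter_op n (Suc i, \<epsilon>) z y)
    = (if a = Suc b then qint (n - a) * K_list n x' * letter_op n (i, \<epsilon>) x' y' else 0)
      + (if a = b then \<Sum>z\<in>basis n l. E_op n x' z * letter_op n (i, \<epsilon>) z y' else 0)"
  proof -
    have "(\<Sum>z\<in>basis n m. E_op n x z * letter_op n (Suc i, \<epsilon>) z y)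
      = (\<Sum>c<n. if c = b then \<Sum>z\<in>basis n l. E_op n x (c # z) * letter_op n (i, \<epsilon>) z y' else 0)"
      unfolding m sum_basis_Suc eq letter_op_Suc by (intro sum.cong refl) simp
    also have "\<dots> = (\<Sum>z\<in>basis n l. E_op n x (b # z) * letter_op n (i, \<epsilon>) z y')"
      using n by (simp add: sum.delta)
    also have "\<dots> = (\<Sum>z\<in>basis n l. if z = x' then if a = Suc b then qint (n - a) * K_list n x' * letter_op n (i, \<epsilon>) z y' else 0 else 0)
        + (\<Sum>z\<in>basis n l. if a = b then E_op n x' z * letter_op n (i, \<epsilon>) z y' else 0)"
      unfolding eq sum.distrib[symmetric] by (intro sum.cong refl) (simp add: distrib_right)
    finally show ?thesis using n fin by (simp add: sum.delta)
  qed
  have R: "(\<Sum>z\<in>basis n m. letter_op n (Suc i, \<epsilon>) x z * E_op n z y)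
    = (if a = Suc b then qint (n - a) * K_list n y' * letter_op n (i, \<epsilon>) x' y' else 0)
      + (if a = b then \<Sum>z\<in>basis n l. letter_op n (i, \<epsilon>) x' z * E_op n z y' else 0)"
  proof -
    have "(\<Sum>z\<in>basis n m. letter_op n (Suc i, \<epsilon>) x z * E_op n z y)
      = (\<Sum>c<n. if a = c then \<Sum>z\<in>basis n l. letter_op n (i, \<epsilon>) x' z * E_op n (c # z) y else 0)"
      unfolding m sum_basis_Suc eq letter_op_Suc by (intro sum.cong refl) simp
    also have "\<dots> = (\<Sum>z\<in>basis n l. letter_op n (i, \<epsilon>) x' z * E_op n (a # z) y)"
      using n by (simp add: sum.delta')
    also have "\<dots> = (\<Sum>z\<in>basis n l. if z = y' then if a = Suc b then qint (n - a) * K_list n y' * letter_op n (i, \<epsilon>) x' z else 0 else 0)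
        + (\<Sum>z\<in>basis n l. if a = b then letter_op n (i, \<epsilon>) x' z * E_op n z y' else 0)"
      unfolding eq sum.distrib[symmetric] by (intro sum.cong refl) (simp add: distrib_left mult_ac)
    finally show ?thesis using n fin by (simp add: sum.delta)
  qed
  \<comment> \<open>When E acts on the first factor, K acts on all later ones, so the letter has to
    commute with K.\<close>
  have "K_list n x' * letter_op n (i, \<epsilon>) x' y' = K_list n y' * letter_op n (i, \<epsilon>) x' y'"
    using letter_op_weight[of n i \<epsilon> x' y'] n Suc.prems m by (auto simp: basis_length)
  then show ?case
    unfolding L R using Suc.IH[of l x' y'] n Suc.prems m by (simp add: mult.assoc)
qed

lemma braid_op_E:
  assumes "\<forall>(i, \<epsilon>)\<in>set w. Suc i < m" "x \<in> basis n m" "y \<in> basis n m"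
  shows "(\<Sum>z\<in>basis n m. E_op n x z * braid_op n m w z y) = (\<Sum>z\<in>basis n m. braid_op n m w x z * E_op n z y)"
  using assms
proof (induction w arbitrary: x)
  case Nil
  then show ?case by (simp add: if_distrib if_distribR sum.delta sum.delta' finite_basis cong: if_cong)
next
  case (Cons g w)
  let ?B = "basis n m" and ?L = "letter_op n g" and ?T = "braid_op n m w"
  have g: "(\<Sum>z\<in>?B. E_op n u z * ?L z v) = (\<Sum>z\<in>?B. ?L u z * E_op n z v)" if "u \<in> ?B" "v \<in> ?B" for u v
    using letter_op_E[of "fst g" m u n v "snd g"] that Cons.prems by (cases g) auto
  have "(\<Sum>z\<in>?B. E_op n x z * braid_op n m (g # w) z y) = (\<Sum>z\<in>?B. \<Sum>u\<in>?B. E_op n x z * ?L z u * ?T u y)"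
    by (simp add: sum_distrib_left mult.assoc)
  also have "\<dots> = (\<Sum>u\<in>?B. (\<Sum>z\<in>?B. E_op n x z * ?L z u) * ?T u y)"
    by (subst sum.swap) (simp add: sum_distrib_right)
  also have "\<dots> = (\<Sum>u\<in>?B. (\<Sum>z\<in>?B. ?L x z * E_op n z u) * ?T u y)"
    using g Cons.prems by (intro sum.cong refl) simp
  also have "\<dots> = (\<Sum>u\<in>?B. \<Sum>z\<in>?B. ?L x z * (E_op n z u * ?T u y))"
    by (simp add: sum_distrib_right mult.assoc)
  also have "\<dots> = (\<Sum>z\<in>?B. ?L x z * (\<Sum>u\<in>?B. E_op n z u * ?T u y))"
    by (subst sum.swap) (simp add: sum_distrib_left)
  also have "\<dots> = (\<Sum>z\<in>?B. ?L x z * (\<Sum>u\<in>?B. ?T z u * E_op n u y))"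
    using Cons by (intro sum.cong refl) auto
  also have "\<dots> = (\<Sum>z\<in>?B. \<Sum>u\<in>?B. ?L x z * ?T z u * E_op n u y)"
    by (simp add: sum_distrib_left mult.assoc)
  also have "\<dots> = (\<Sum>u\<in>?B. braid_op n m (g # w) x u * E_op n u y)"
    by (subst sum.swap) (simp add: sum_distrib_right)
  finally show ?case .
qed

section \<open>Opening one strand of the closed braid\<close>

text \<open>The diagonal entry at \<open>a\<close> of the endomorphism of \<open>V\<^sub>n\<close>
  that remains when every strand but the first is closed by the quantum trace.\<close>

definition open_trace :: "nat \<Rightarrow> nat \<Rightarrow> braid_word \<Rightarrow> nat \<Rightarrow> laurent" where
  "open_trace n m w a = (\<Sum>x\<in>basis n m. braid_op n (Suc m) w (a # x) (a # x) * K_list n x)"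

text \<open>Compare the coefficients of \<open>a # x\<close> in the images of
  \<open>Suc a # x\<close> under the two composites of E with the braid, and sum over
  \<open>x\<close>. Where E acts on the open strand, its coproduct supplies exactly the weight
  \<open>K_list n x\<close> of the quantum trace. Where E acts on the closed strands, the two sides
  agree by cyclicity of the trace. Finally the nonzero factor [n - a - 1] is cancelled.\<close>

lemma open_trace_Suc:
  assumes w: "\<forall>(i, \<epsilon>)\<in>set w. Suc i < Suc m" and a: "Suc a < n"
  shows "open_trace n m w (Suc a) = open_trace n m w a"
proof -
  let ?B = "basis n m" and ?T = "braid_op n (Suc m) w" and ?e = "qint (n - Suc a)"
  have *: "?e * (?T (a # x) (a # x) * K_list n x) + (\<Sum>z\<in>?B. E_op n x z * ?T (Suc a # z) (a # x))
      = ?e * (?T (Suc a # x) (Suc a # x) * K_list n x) + (\<Sum>z\<in>?B. ?T (Suc a # x) (a # z) * E_op n z x)"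
    if x: "x \<in> ?B" for x
  proof -
    have "(\<Sum>z\<in>basis n (Suc m). E_op n (Suc a # x) z * ?T z (a # x))
       = (\<Sum>z\<in>?B. \<Sum>c<n. E_op n (Suc a # x) (c # z) * ?T (c # z) (a # x))"
      unfolding sum_basis_Suc by (rule sum.swap)
    also have "\<dots> = (\<Sum>z\<in>?B. if z = x then ?e * K_list n x * ?T (a # z) (a # x) else 0)
        + (\<Sum>z\<in>?B. E_op n x z * ?T (Suc a # z) (a # x))"
      unfolding sum_E_op_left[OF a] sum.distrib by (intro arg_cong2[of _ _ _ _ "(+)"] sum.cong refl) auto
    finally have 1: "(\<Sum>z\<in>basis n (Suc m). E_op n (Suc a # x) z * ?T z (a # x))
       = ?e * (?T (a # x) (a # x) * K_list n x) + (\<Sum>z\<in>?B. E_op n x z * ?T (Suc a # z) (a # x))"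
      using x by (simp add: sum.delta finite_basis mult_ac)
    have "(\<Sum>z\<in>basis n (Suc m). ?T (Suc a # x) z * E_op n z (a # x))
       = (\<Sum>z\<in>?B. \<Sum>c<n. ?T (Suc a # x) (c # z) * E_op n (c # z) (a # x))"
      unfolding sum_basis_Suc by (rule sum.swap)
    also have "\<dots> = (\<Sum>z\<in>?B. if z = x then ?T (Suc a # x) (Suc a # z) * (?e * K_list n x) else 0)
        + (\<Sum>z\<in>?B. ?T (Suc a # x) (a # z) * E_op n z x)"
      unfolding sum_E_op_right[OF Suc_lessD[OF a]] sum.distrib using a
      by (intro arg_cong2[of _ _ _ _ "(+)"] sum.cong refl) auto
    finally have 2: "(\<Sum>z\<in>basis n (Suc m). ?T (Suc a # x) z * E_op n z (a # x))
       = ?e * (?T (Suc a # x) (Suc a # x) * K_list n x) + (\<Sum>z\<in>?B. ?T (Suc a # x) (a # z) * E_op n z x)"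
      using x by (simp add: sum.delta finite_basis mult_ac)
    show ?thesis
      using braid_op_E[OF w, of "Suc a # x" n "a # x"] x a unfolding 1 2 by simp
  qed
  have "?e * open_trace n m w a + (\<Sum>x\<in>?B. \<Sum>z\<in>?B. E_op n x z * ?T (Suc a # z) (a # x))
      = ?e * open_trace n m w (Suc a) + (\<Sum>x\<in>?B. \<Sum>z\<in>?B. ?T (Suc a # x) (a # z) * E_op n z x)"
    unfolding open_trace_def sum_distrib_left sum.distrib[symmetric] by (rule sum.cong[OF refl *])
  moreover have "(\<Sum>x\<in>?B. \<Sum>z\<in>?B. E_op n x z * ?T (Suc a # z) (a # x))
      = (\<Sum>x\<in>?B. \<Sum>z\<in>?B. ?T (Suc a # x) (a # z) * E_op n z x)"
    by (subst sum.swap) (simp add: mult.commute)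
  ultimately have "?e * open_trace n m w a = ?e * open_trace n m w (Suc a)" by simp
  then show ?thesis using qint_nonzero[of "n - Suc a"] a by simp
qed

lemma quantum_trace_open:
  assumes w: "\<forall>(i, \<epsilon>)\<in>set w. Suc i < Suc m"
  shows "quantum_trace n (Suc m) w = open_trace n m w 0 * quantum_trace n 1 []"
proof -
  have a: "a < n \<Longrightarrow> open_trace n m w a = open_trace n m w 0" for a
    by (induction a) (simp_all add: open_trace_Suc[OF w])
  have "quantum_trace n (Suc m) w
      = (\<Sum>z\<in>basis n (Suc m). braid_op n (Suc m) w z z * K_list n z)"
    unfolding quantum_trace_def by (intro sum.cong refl) (simp add: K_list_nth basis_length)
  also have "\<dots> = (\<Sum>a<n. K_weight n a * open_trace n m w a)"
    by (simp add: sum_basis_Suc open_trace_def sum_distrib_left mult_ac)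
  also have "\<dots> = (\<Sum>a<n. K_weight n a * open_trace n m w 0)"
    by (intro sum.cong refl) (metis a lessThan_iff)
  also have "\<dots> = open_trace n m w 0 * quantum_trace n 1 []"
    unfolding sum_distrib_right[symmetric]
    by (simp add: quantum_trace_def sum_basis_Suc mult.commute)
  finally show ?thesis .
qed

lemma quantum_trace_unknot: "quantum_trace n 1 [] = qint n"
  by (simp add: quantum_trace_def sum_basis_Suc qint_def K_weight_def)

section \<open>Expansions in the q-Pochhammer basis\<close>

definition poch :: "nat \<Rightarrow> nat \<Rightarrow> laurent" where
  "poch n k = qpochhammer (var_pow (- int n + 1)) (var_pow 1) k"

lemma poch_prod: "poch n k = (\<Prod>t<k. 1 - var_pow (int t + 1 - int n))"
  unfolding poch_def qpochhammer_def
  by (intro prod.cong refl) (simp add: var_pow_power algebra_simps flip: var_pow_add)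

lemma poch_Suc: "poch n (Suc k) = poch n k * (1 - var_pow (int k + 1 - int n))"
  by (simp add: poch_prod)

lemma poch_eq_0: "0 < n \<Longrightarrow> n \<le> k \<Longrightarrow> poch n k = 0"
  by (auto simp: poch_prod intro!: bexI[of _ "n - 1"])

text \<open>The coefficients may not depend on n. Stopping at \<open>k < n\<close> loses nothing,
  since later Pochhammer symbols vanish. The index \<open>M\<close> keeps track of divisibility by
  (X;q)_M for X = q^(1-n).\<close>

definition pochhammer_sum :: "nat \<Rightarrow> (nat \<Rightarrow> laurent) \<Rightarrow> bool" where
  "pochhammer_sum M g \<longleftrightarrow>
     (\<exists>a. (\<forall>k<M. a k = 0) \<and> (\<forall>n>0. g n = (\<Sum>k<n. a k * poch n k)))"

lemma pochhammer_sum_poch: "pochhammer_sum M (\<lambda>n. poch n M)"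
  unfolding pochhammer_sum_def
proof (intro exI[of _ "\<lambda>k. if k = M then 1 else 0"] conjI allI impI)
  fix n :: nat assume "0 < n"
  have "(\<Sum>k<n. (if k = M then 1 else 0) * poch n k) = (\<Sum>k<n. if k = M then poch n k else 0)"
    by (intro sum.cong refl) simp
  then show "poch n M = (\<Sum>k<n. (if k = M then 1 else 0) * poch n k)"
    using \<open>0 < n\<close> by (simp add: sum.delta poch_eq_0)
qed simp

lemma pochhammer_sum_cmult: "pochhammer_sum M g \<Longrightarrow> pochhammer_sum M (\<lambda>n. c * g n)"
  unfolding pochhammer_sum_def
proof (elim exE conjE)
  fix a assume "\<forall>k<M. a k = 0" "\<forall>n>0. g n = (\<Sum>k<n. a k * poch n k)"
  then show "\<exists>a. (\<forall>k<M. a k = 0) \<and> (\<forall>n>0. c * g n = (\<Sum>k<n. a k * poch n k))"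
    by (intro exI[of _ "\<lambda>k. c * a k"]) (simp add: sum_distrib_left mult.assoc)
qed

lemma pochhammer_sum_add:
  "pochhammer_sum M f \<Longrightarrow> pochhammer_sum M g \<Longrightarrow> pochhammer_sum M (\<lambda>n. f n + g n)"
  unfolding pochhammer_sum_def
proof (elim exE conjE)
  fix a b assume "\<forall>k<M. a k = 0" "\<forall>n>0. f n = (\<Sum>k<n. a k * poch n k)"
    and "\<forall>k<M. b k = 0" "\<forall>n>0. g n = (\<Sum>k<n. b k * poch n k)"
  then show "\<exists>a. (\<forall>k<M. a k = 0) \<and> (\<forall>n>0. f n + g n = (\<Sum>k<n. a k * poch n k))"
    by (intro exI[of _ "\<lambda>k. a k + b k"]) (simp add: sum.distrib distrib_right)
qed

lemma pochhammer_sum_0: "pochhammer_sum M (\<lambda>n. 0)"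
  unfolding pochhammer_sum_def by (intro exI[of _ "\<lambda>k. 0"]) simp

text \<open>With \<open>X = q\<^bsup>1-n\<^esup>\<close> one has \<open>X (X;q)\<^sub>k = q\<^bsup>-k\<^esup> ((X;q)\<^sub>k - (X;q)\<^bsub>k+1\<^esub>)\<close>.\<close>

lemma var_pow_times_poch_sum:
  assumes "0 < n"
  shows "var_pow (1 - int n) * (\<Sum>k<n. a k * poch n k)
    = (\<Sum>k<n. (var_pow (- int k) * a k - (if k = 0 then 0 else var_pow (1 - int k) * a (k - 1))) * poch n k)"
proof -
  have X: "var_pow (1 - int n) * poch n k = var_pow (- int k) * (poch n k - poch n (Suc k))" for k
  proof -
    have "var_pow (- int k) * (poch n k - poch n (Suc k)) = var_pow (- int k) * var_pow (int k + 1 - int n) * poch n k"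
      by (simp add: poch_Suc algebra_simps)
    also have "\<dots> = var_pow (1 - int n) * poch n k" by (simp flip: var_pow_add)
    finally show ?thesis ..
  qed
  have "(\<Sum>k<n. var_pow (- int k) * a k * poch n (Suc k))
      = (\<Sum>k<Suc n. (if k = 0 then 0 else var_pow (1 - int k) * a (k - 1)) * poch n k)"
    by (simp only: sum.lessThan_Suc_shift) simp
  \<comment> \<open>The shift has produced a term with \<open>k = n\<close>, which contains
    \<open>poch n n = 0\<close>.\<close>
  also have "\<dots> = (\<Sum>k<n. (if k = 0 then 0 else var_pow (1 - int k) * a (k - 1)) * poch n k)"
    using assms by (simp add: poch_eq_0)
  finally have shift: "(\<Sum>k<n. var_pow (- int k) * a k * poch n (Suc k)) = \<dots>" .
  have "var_pow (1 - int n) * (\<Sum>k<n. a k * poch n k) = (\<Sum>k<n. a k * (var_pow (1 - int n) * poch n k))"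
    by (simp add: sum_distrib_left mult_ac)
  also have "\<dots> = (\<Sum>k<n. var_pow (- int k) * a k * poch n k) - (\<Sum>k<n. var_pow (- int k) * a k * poch n (Suc k))"
    unfolding X by (simp add: algebra_simps sum_subtractf)
  also have "\<dots> = (\<Sum>k<n. (var_pow (- int k) * a k - (if k = 0 then 0 else var_pow (1 - int k) * a (k - 1))) * poch n k)"
    unfolding shift by (simp only: left_diff_distrib sum_subtractf)
  finally show ?thesis .
qed

lemma pochhammer_sum_var_pow:
  assumes "pochhammer_sum M g"
  shows "pochhammer_sum M (\<lambda>n. var_pow (1 - int n) * g n)"
proof -
  obtain a where a: "\<forall>k<M. a k = 0" "\<forall>n>0. g n = (\<Sum>k<n. a k * poch n k)"
    using assms by (auto simp: pochhammer_sum_def)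
  show ?thesis
    unfolding pochhammer_sum_def
    by (rule exI[of _ "\<lambda>k. var_pow (- int k) * a k - (if k = 0 then 0 else var_pow (1 - int k) * a (k - 1))"])
      (use a in \<open>simp add: var_pow_times_poch_sum\<close>)
qed

text \<open>The coefficients for X^(-1) must solve q^(-k) b_k - q^(-(k-1)) b_(k-1) = a_k. This
  telescopes, so q^(-k) b_k is a partial sum of the a_j. A finite expansion can thus become
  infinite.\<close>

lemma pochhammer_sum_var_pow_inverse:
  assumes "pochhammer_sum M g"
  shows "pochhammer_sum M (\<lambda>n. var_pow (int n - 1) * g n)"
proof -
  obtain a where a: "\<forall>k<M. a k = 0" "\<forall>n>0. g n = (\<Sum>k<n. a k * poch n k)"
    using assms by (auto simp: pochhammer_sum_def)
  define b where "b k = var_pow (int k) * (\<Sum>j\<le>k. a j)" for k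
  have b: "var_pow (- int k) * b k - (if k = 0 then 0 else var_pow (1 - int k) * b (k - 1)) = a k" for k
    by (cases k) (simp_all add: b_def flip: mult.assoc var_pow_add)
  have "var_pow (int n - 1) * g n = (\<Sum>k<n. b k * poch n k)" if "0 < n" for n
  proof -
    have "g n = var_pow (1 - int n) * (\<Sum>k<n. b k * poch n k)"
      using that a by (simp only: var_pow_times_poch_sum b)
    then show ?thesis by (simp flip: mult.assoc var_pow_add)
  qed
  moreover have "\<forall>k<M. b k = 0" using a by (simp add: b_def)
  ultimately show ?thesis unfolding pochhammer_sum_def by blast
qed

lemma pochhammer_sum_var_pow_int:
  assumes "pochhammer_sum M g"
  shows "pochhammer_sum M (\<lambda>n. var_pow (b * (int n - 1)) * g n)"
proof (induction b rule: int_induct[where k = 0])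
  case base
  then show ?case using assms by simp
next
  case (step1 i)
  from pochhammer_sum_var_pow_inverse[OF this(2)] show ?case
    by (simp add: algebra_simps flip: mult.assoc var_pow_add)
next
  case (step2 i)
  from pochhammer_sum_var_pow[OF this(2)] show ?case
    by (simp add: algebra_simps flip: mult.assoc var_pow_add)
qed

section \<open>Factors contributed by drops of an index\<close>

text \<open>The factor for \<open>t\<close> vanishes at n = t + 1. A multiset is used because
  several crossings may contribute the same \<open>t\<close>.\<close>

definition drop_prod :: "nat multiset \<Rightarrow> nat \<Rightarrow> laurent" where
  "drop_prod T n = (\<Prod>t\<in>#T. 1 - var_pow (int t + 1 - int n))"

lemma drop_prod_mset_set: "drop_prod (mset_set A) n = (\<Prod>t\<in>A. 1 - var_pow (int t + 1 - int n))"
  by (simp add: drop_prod_def prod_unfold_prod_mset)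

lemma drop_prod_union: "drop_prod (S + T) n = drop_prod S n * drop_prod T n"
  by (simp add: drop_prod_def)

lemma drop_prod_eq_0: "0 < n \<Longrightarrow> n - 1 \<in># T \<Longrightarrow> drop_prod T n = 0"
  by (auto simp: drop_prod_def prod_mset_zero_iff image_iff intro!: bexI[of _ "n - 1"])

lemma pochhammer_sum_drop_prod:
  assumes "pochhammer_sum M g"
  shows "pochhammer_sum M (\<lambda>n. drop_prod T n * g n)"
proof (induction T)
  case empty
  then show ?case using assms by (simp add: drop_prod_def)
next
  case (add t T)
  have "pochhammer_sum M (\<lambda>n. drop_prod T n * g n
      + (- var_pow (int t)) * (var_pow (1 - int n) * (drop_prod T n * g n)))"
    by (intro pochhammer_sum_add pochhammer_sum_cmult pochhammer_sum_var_pow add)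
  moreover have "drop_prod T n * g n
      + (- var_pow (int t)) * (var_pow (1 - int n) * (drop_prod T n * g n)) = drop_prod (add_mset t T) n * g n" for n
  proof -
    have "var_pow (int t + 1 - int n) = var_pow (int t) * var_pow (1 - int n)" by (simp flip: var_pow_add)
    then show ?thesis by (simp add: drop_prod_def algebra_simps)
  qed
  ultimately show ?case by simp
qed

text \<open>One copy of each \<open>t < M\<close> makes up (X;q)_M. All remaining factors are
  Laurent polynomials in X, under which the expansions starting at \<open>M\<close> are
  stable.\<close>

lemma pochhammer_sum_drop_prod_initial:
  assumes "\<forall>t<M. t \<in># T"
  shows "pochhammer_sum M (\<lambda>n. var_pow (b * (int n - 1)) * (c * drop_prod T n))"
proof -
  have "mset_set {..<M} \<subseteq># T"
    using assms by (auto simp: subseteq_mset_def count_mset_set' Suc_le_eq)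
  then obtain T' where T: "T = T' + mset_set {..<M}"
    by (metis subset_mset.diff_add)
  have "drop_prod T n = drop_prod T' n * poch n M" for n
    by (simp add: T drop_prod_union drop_prod_mset_set poch_prod)
  then show ?thesis
    by (simp add: pochhammer_sum_var_pow_int pochhammer_sum_cmult pochhammer_sum_drop_prod pochhammer_sum_poch)
qed

section \<open>State sums\<close>

text \<open>\<open>\<Sum>\<^bsub>p<q\<^esub> x\<^sub>p x\<^sub>q\<close> and \<open>\<Sum>\<^sub>p p x\<^sub>p\<close>, the exponents of the sign changes of basis that make the
  parity of the exponent of \<open>v\<close> the same for all entries of the R-matrix.\<close>

fun pair_sum :: "nat list \<Rightarrow> nat" where
  "pair_sum [] = 0"
| "pair_sum (a # x) = a * sum_list x + pair_sum x"

fun moment :: "nat list \<Rightarrow> nat" where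
  "moment [] = 0"
| "moment (a # x) = sum_list x + moment x"

text \<open>If an index of at least \<open>t + 1\<close> drops to at most \<open>t\<close> somewhere along the permutation \<open>\<sigma>\<close>, then
  the factor that vanishes for \<open>n = t + 1\<close> occurs.\<close>

definition state_term :: "(nat \<Rightarrow> nat) \<Rightarrow> nat \<Rightarrow> nat list \<Rightarrow> nat list \<Rightarrow> (nat \<Rightarrow> laurent) \<Rightarrow> bool" where
  "state_term \<sigma> l x y f \<longleftrightarrow> (\<exists>\<alpha> \<beta> c T.
     (\<forall>n. f n = var_pow (\<alpha> + \<beta> * (int n - 1)) * subst_square (c * drop_prod T n)) \<and>
     even (\<alpha> + int (pair_sum x) + int (pair_sum y)) \<and>
     even (\<beta> + int (moment x) + int (moment y) + int l) \<and>
     (\<forall>t p. t \<notin># T \<longrightarrow> p < length x \<longrightarrow> t < x ! p \<longrightarrow> t < y ! \<sigma> p))"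

text \<open>Finite sums of state terms with the same ends. They are functions of n, so a single
  expression serves all colors at once.\<close>

inductive state_fun :: "(nat \<Rightarrow> nat) \<Rightarrow> nat \<Rightarrow> nat list \<Rightarrow> nat list \<Rightarrow> (nat \<Rightarrow> laurent) \<Rightarrow> bool"
  for \<sigma> l x y where
  zero: "state_fun \<sigma> l x y (\<lambda>n. 0)"
| add: "state_term \<sigma> l x y f \<Longrightarrow> state_fun \<sigma> l x y g \<Longrightarrow> state_fun \<sigma> l x y (\<lambda>n. f n + g n)"

lemma state_fun_term: "state_term \<sigma> l x y f \<Longrightarrow> state_fun \<sigma> l x y f"
  using state_fun.add[OF _ state_fun.zero] by simp

lemma state_fun_add:
  "state_fun \<sigma> l x y f \<Longrightarrow> state_fun \<sigma> l x y g \<Longrightarrow> state_fun \<sigma> l x y (\<lambda>n. f n + g n)"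
  by (induction rule: state_fun.induct) (simp_all add: add.assoc state_fun.add)

lemma state_fun_sum:
  "(\<And>z. z \<in> Z \<Longrightarrow> state_fun \<sigma> l x y (f z)) \<Longrightarrow> state_fun \<sigma> l x y (\<lambda>n. \<Sum>z\<in>Z. f z n)"
  by (induction Z rule: infinite_finite_induct) (simp_all add: state_fun.zero state_fun_add)

text \<open>The intermediate state \<open>z\<close> enters each parity condition twice and so
  disappears. A drop along the composite permutation must happen along one of its two parts.\<close>

lemma state_term_mult:
  assumes f: "state_term \<sigma> l x z f" and g: "state_term \<tau> l' z y g"
    and \<sigma>: "\<And>p. p < length x \<Longrightarrow> \<sigma> p < length z"
  shows "state_term (\<tau> \<circ> \<sigma>) (l + l') x y (\<lambda>n. f n * g n)"
proof -
  obtain \<alpha> \<beta> c T where f: "\<And>n. f n = var_pow (\<alpha> + \<beta> * (int n - 1)) * subst_square (c * drop_prod T n)"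
    "even (\<alpha> + int (pair_sum x) + int (pair_sum z))" "even (\<beta> + int (moment x) + int (moment z) + int l)"
    "\<And>t p. t \<notin># T \<Longrightarrow> p < length x \<Longrightarrow> t < x ! p \<Longrightarrow> t < z ! \<sigma> p"
    using f unfolding state_term_def by metis
  obtain \<alpha>' \<beta>' c' T' where g: "\<And>n. g n = var_pow (\<alpha>' + \<beta>' * (int n - 1)) * subst_square (c' * drop_prod T' n)"
    "even (\<alpha>' + int (pair_sum z) + int (pair_sum y))" "even (\<beta>' + int (moment z) + int (moment y) + int l')"
    "\<And>t p. t \<notin># T' \<Longrightarrow> p < length z \<Longrightarrow> t < z ! p \<Longrightarrow> t < y ! \<tau> p"
    using g unfolding state_term_def by metis
  show ?thesis
    unfolding state_term_def
  proof (rule exI[of _ "\<alpha> + \<alpha>'"], rule exI[of _ "\<beta> + \<beta>'"], rule exI[of _ "c * c'"], rule exI[of _ "T + T'"], intro conjI allI impI)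
    fix n
    have "var_pow (\<alpha> + \<alpha>' + (\<beta> + \<beta>') * (int n - 1))
        = var_pow (\<alpha> + \<beta> * (int n - 1)) * var_pow (\<alpha>' + \<beta>' * (int n - 1))"
      by (simp add: algebra_simps flip: var_pow_add)
    then show "f n * g n = var_pow (\<alpha> + \<alpha>' + (\<beta> + \<beta>') * (int n - 1)) * subst_square (c * c' * drop_prod (T + T') n)"
      by (simp add: f(1) g(1) drop_prod_def subst_square_mult mult_ac)
  next
    have "even ((\<alpha> + int (pair_sum x) + int (pair_sum z)) + (\<alpha>' + int (pair_sum z) + int (pair_sum y)))"
      using f(2) g(2) by (rule dvd_add)
    moreover have "(\<alpha> + int (pair_sum x) + int (pair_sum z)) + (\<alpha>' + int (pair_sum z) + int (pair_sum y))
        = \<alpha> + \<alpha>' + int (pair_sum x) + int (pair_sum y) + 2 * int (pair_sum z)" by simp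
    ultimately show "even (\<alpha> + \<alpha>' + int (pair_sum x) + int (pair_sum y))" by simp
  next
    have "even ((\<beta> + int (moment x) + int (moment z) + int l) + (\<beta>' + int (moment z) + int (moment y) + int l'))"
      using f(3) g(3) by (rule dvd_add)
    moreover have "(\<beta> + int (moment x) + int (moment z) + int l) + (\<beta>' + int (moment z) + int (moment y) + int l')
        = \<beta> + \<beta>' + int (moment x) + int (moment y) + int (l + l') + 2 * int (moment z)" by simp
    ultimately show "even (\<beta> + \<beta>' + int (moment x) + int (moment y) + int (l + l'))" by simp
  next
    fix t p assume "t \<notin># T + T'" "p < length x" "t < x ! p"
    then show "t < y ! (\<tau> \<circ> \<sigma>) p" using f(4)[of t p] g(4)[of t "\<sigma> p"] \<sigma> by simp
  qed
qed

lemma state_fun_mult: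
  assumes f: "state_fun \<sigma> l x z f" and g: "state_fun \<tau> l' z y g"
    and \<sigma>: "\<And>p. p < length x \<Longrightarrow> \<sigma> p < length z"
  shows "state_fun (\<tau> \<circ> \<sigma>) (l + l') x y (\<lambda>n. f n * g n)"
  using f
proof induction
  case zero
  then show ?case by (simp add: state_fun.zero)
next
  case (add f f')
  have "state_fun (\<tau> \<circ> \<sigma>) (l + l') x y (\<lambda>n. f n * g n)"
    using g
  proof induction
    case zero
    then show ?case by (simp add: state_fun.zero)
  next
    case (add g g')
    show ?case
      unfolding distrib_left
      by (rule state_fun.add[OF state_term_mult[OF \<open>state_term \<sigma> l x z f\<close> add.hyps(1) \<sigma>] add.IH])
  qed
  then show ?case using add.IH unfolding distrib_right by (rule state_fun_add)
qed

text \<open>An index of at least n that ends below n drops at t = n - 1, and the factor for this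
  drop is 1 - q^0 = 0. This permits sums over states whose range does not depend on n.\<close>

lemma state_fun_vanish:
  assumes "state_fun \<sigma> l x y f" "x \<notin> basis n m" "y \<in> basis n m" "length x = m"
    and \<sigma>: "\<And>p. p < m \<Longrightarrow> \<sigma> p < m"
  shows "f n = 0"
  using assms(1)
proof induction
  case (add f g)
  obtain p where p: "p < m" "n \<le> x ! p"
    using assms by (auto simp: basis_def in_set_conv_nth not_less subset_iff)
  have "y ! \<sigma> p \<in> set y" using assms(3) \<sigma>[OF p(1)] by (simp add: basis_length)
  then have y: "y ! \<sigma> p < n" using assms(3) by (auto simp: basis_def)
  obtain \<alpha> \<beta> c T where f: "f n = var_pow (\<alpha> + \<beta> * (int n - 1)) * subst_square (c * drop_prod T n)"
    "\<And>t p. t \<notin># T \<Longrightarrow> p < length x \<Longrightarrow> t < x ! p \<Longrightarrow> t < y ! \<sigma> p"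
    using add.hyps(1) unfolding state_term_def by metis
  have "n - 1 \<in># T" using f(2)[of "n - 1" p] p y assms(4) by fastforce
  then show ?case using add y by (simp add: f drop_prod_eq_0)
qed simp

section \<open>Crossings and letters as state functions\<close>

lemma sum_int_lessThan: "(\<Sum>t = r..<r + k. int t) = int r * int k + int (k * (k - 1) div 2)"
proof (induction k)
  case (Suc k)
  have "Suc k * (Suc k - 1) div 2 = k * (k - 1) div 2 + k"
    by (cases k) (simp_all add: algebra_simps)
  then show ?case using Suc by (simp add: algebra_simps)
qed simp

text \<open>Lowering an index from t + 1 to t costs [n - 1 - t], by \<open>qdiff_eq\<close> a
  monomial times 1 - q^(t+1-n). The k-th power of E passes through every t from r to r + k -
  1.\<close>

lemma prod_qdiff_drop:
  assumes "r + k < n"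
  shows "(\<Prod>l<k. qdiff (int (n - (r + k) + l))) =
    var_pow (int k * (int n - 1) - (int r * int k + int (k * (k - 1) div 2))) *
    subst_square (drop_prod (mset_set {r..<r + k}) n)"
proof -
  have "(\<Prod>l<k. qdiff (int (n - (r + k) + l))) = (\<Prod>t\<in>{r..<r + k}. qdiff (int n - 1 - int t))"
    by (rule prod.reindex_bij_witness[where i = "\<lambda>t. r + k - 1 - t" and j = "\<lambda>l. r + k - 1 - l"])
      (use assms in \<open>auto simp: of_nat_diff algebra_simps\<close>)
  also have "\<dots> = (\<Prod>t\<in>{r..<r + k}. var_pow (int n - 1 - int t) * subst_square (1 - var_pow (int t + 1 - int n)))"
    by (intro prod.cong refl) (simp add: qdiff_eq algebra_simps)
  also have "\<dots> = var_pow (\<Sum>t\<in>{r..<r + k}. int n - 1 - int t) * subst_square (drop_prod (mset_set {r..<r + k}) n)"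
    by (simp add: prod.distrib var_pow_sum subst_square_prod drop_prod_mset_set)
  also have "(\<Sum>t\<in>{r..<r + k}. int n - 1 - int t)
      = int k * (int n - 1) - (int r * int k + int (k * (k - 1) div 2))"
    unfolding sum_int_lessThan[symmetric] by (simp add: sum_subtractf)
  finally show ?thesis .
qed

text \<open>The exponents k(k-1)/2 of the prefactor and of the product of \<open>qdiff\<close>s add
  up to an even number. Modulo 2 this leaves r k + j k, which for i = r + k and s = j + k is r s + i
  j.\<close>

lemma theta_state:
  assumes \<delta>: "\<delta> = 1 \<or> \<delta> = -1" and r: "r \<le> i" "r + s = i + j"
  shows "\<exists>\<alpha> c. even (\<alpha> + int r * int s + int i * int j) \<and> (\<forall>n>i. theta n \<delta> i j r s =
    var_pow (\<alpha> + int (i - r) * (int n - 1)) * subst_square (c * drop_prod (mset_set {r..<i}) n))"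
proof -
  define k where "k = i - r"
  have i: "i = r + k" and s: "s = j + k" using r by (auto simp: k_def)
  define h where "h = int (k * (k - 1) div 2)"
  obtain c where c: "qbinom s k = var_pow (int (j * k)) * subst_square c"
    using qbinom_even s by blast
  define \<alpha> where "\<alpha> = \<delta> * h - (int r * int k + h) + int (j * k)"
  have "theta n \<delta> i j r s = var_pow (\<alpha> + int (i - r) * (int n - 1)) *
      subst_square (of_int \<delta> ^ k * c * drop_prod (mset_set {r..<i}) n)" if "i < n" for n
  proof -
    have "theta n \<delta> i j r s = of_int \<delta> ^ k * var_pow (\<delta> * h) *
      (\<Prod>l<k. qdiff (int (n - (r + k) + l))) * qbinom s k"
      unfolding theta_def h_def using r by (simp add: k_def)
    also have "\<dots> = of_int \<delta> ^ k * var_pow (\<delta> * h) *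
      (var_pow (int k * (int n - 1) - (int r * int k + h)) * subst_square (drop_prod (mset_set {r..<i}) n)) *
      (var_pow (int (j * k)) * subst_square c)"
      using that unfolding c i h_def by (subst prod_qdiff_drop) simp_all
    also have "\<dots> = (var_pow (\<delta> * h) * var_pow (int k * (int n - 1) - (int r * int k + h)) * var_pow (int (j * k))) *
        (of_int \<delta> ^ k * subst_square c * subst_square (drop_prod (mset_set {r..<i}) n))"
      by (simp only: mult_ac)
    also have "var_pow (\<delta> * h) * var_pow (int k * (int n - 1) - (int r * int k + h)) * var_pow (int (j * k))
        = var_pow (\<alpha> + int (i - r) * (int n - 1))"
      by (simp add: \<alpha>_def i algebra_simps flip: var_pow_add)
    also have "of_int \<delta> ^ k = subst_square (of_int \<delta> ^ k)"
      using \<delta> by (auto simp: subst_square_power subst_square_uminus)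
    finally show ?thesis by (simp only: subst_square_mult)
  qed
  moreover have "even (\<alpha> + int r * int s + int i * int j)"
    using \<delta> by (auto simp: \<alpha>_def i s algebra_simps)
  ultimately show ?thesis by blast
qed

text \<open>The strand acted on by E drops through the interval \<open>T\<close>; the one acted on
  by F never drops. The common tail \<open>x\<close> changes both parities by an even amount,
  because the index sum of the crossing is preserved.\<close>

lemma crossing_state:
  assumes "a + a' = b + b'"
  shows "\<exists>f. state_fun (Transposition.transpose 0 (Suc 0)) (Suc 0) (a # a' # x) (b # b' # x) f \<and>
    (\<forall>n. a < n \<longrightarrow> a' < n \<longrightarrow> b < n \<longrightarrow> b' < n \<longrightarrow> f n = crossing n \<epsilon> a a' b b')"
proof (cases "if \<epsilon> then b \<le> a' else b' \<le> a")
  case False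
  then have "a < n \<longrightarrow> a' < n \<longrightarrow> b < n \<longrightarrow> b' < n \<longrightarrow> crossing n \<epsilon> a a' b b' = 0" for n
    by (auto simp: crossing_def R_inverse_theta R_matrix_theta theta_def split: if_splits)
  then show ?thesis by (intro exI[of _ "\<lambda>n. 0"]) (simp add: state_fun.zero)
next
  case True
  obtain \<alpha> \<beta> c T where f: "\<And>n. a < n \<Longrightarrow> a' < n \<Longrightarrow> b < n \<Longrightarrow> b' < n \<Longrightarrow>
      crossing n \<epsilon> a a' b b' = var_pow (\<alpha> + \<beta> * (int n - 1)) * subst_square (c * drop_prod T n)"
    and \<alpha>: "even (\<alpha> + int a * int a' + int b * int b')" and \<beta>: "even (\<beta> + int a' + int b' + 1)"
    and T: "\<And>t. t \<notin># T \<Longrightarrow> (t < a \<longrightarrow> t < b') \<and> (t < a' \<longrightarrow> t < b)"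
  proof (cases \<epsilon>)
    case \<epsilon>: True
    then have b: "b \<le> a'" "b + b' = a' + a" using True assms by auto
    obtain \<alpha> c where \<alpha>: "even (\<alpha> + int b * int b' + int a' * int a)" and
      c: "\<forall>n>a'. theta n (-1) a' a b b' =
        var_pow (\<alpha> + int (a' - b) * (int n - 1)) * subst_square (c * drop_prod (mset_set {b..<a'}) n)"
      using theta_state[of "-1", OF _ b] by auto
    \<comment> \<open>The negated \<open>cartan_exp\<close> adds \<open>- 2 * a' * a\<close> to
      \<alpha> and \<open>a + a' + 1\<close> to the coefficient \<beta> of n - 1.\<close>
    show thesis
    proof (rule that[of "\<alpha> - 2 * int a' * int a" "int (a' - b) + int a + int a' + 1" c "mset_set {b..<a'}"])
      fix n assume n: "a < n" "a' < n" "b < n" "b' < n"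
      have "crossing n \<epsilon> a a' b b' = var_pow (\<alpha> + int (a' - b) * (int n - 1)) * var_pow (- cartan_exp n a' a)
          * subst_square (c * drop_prod (mset_set {b..<a'}) n)"
        using \<epsilon> n c by (simp add: crossing_def R_inverse_theta mult_ac)
      also have "var_pow (\<alpha> + int (a' - b) * (int n - 1)) * var_pow (- cartan_exp n a' a)
          = var_pow (\<alpha> - 2 * int a' * int a + (int (a' - b) + int a + int a' + 1) * (int n - 1))"
        unfolding cartan_exp_def var_pow_add[symmetric] by (rule arg_cong[of _ _ var_pow]) (simp add: algebra_simps)
      finally show "crossing n \<epsilon> a a' b b' = \<dots> * subst_square (c * drop_prod (mset_set {b..<a'}) n)" .
    next
      show "even (\<alpha> - 2 * int a' * int a + int a * int a' + int b * int b')"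
        using \<alpha> by auto
      have "int (a' - b) + int a + int a' + 1 + int a' + int b' + 1 = 2 * (int a' + int b' + 1)"
        using b by (simp add: of_nat_diff)
      then show "even (int (a' - b) + int a + int a' + 1 + int a' + int b' + 1)" by simp
      show "(t < a \<longrightarrow> t < b') \<and> (t < a' \<longrightarrow> t < b)" if "t \<notin># mset_set {b..<a'}" for t
        using that b by auto
    qed
  next
    case \<epsilon>: False
    then have b: "b' \<le> a" "b' + b = a + a'" using True assms by auto
    obtain \<alpha> c where \<alpha>: "even (\<alpha> + int b' * int b + int a * int a')" and
      c: "\<forall>n>a. theta n 1 a a' b' b =
        var_pow (\<alpha> + int (a - b') * (int n - 1)) * subst_square (c * drop_prod (mset_set {b'..<a}) n)"
      using theta_state[of 1, OF _ b] by auto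
    show thesis
    proof (rule that[of "\<alpha> + 2 * int b' * int b" "int (a - b') - (int b' + int b + 1)" c "mset_set {b'..<a}"])
      fix n assume n: "a < n" "a' < n" "b < n" "b' < n"
      have "crossing n \<epsilon> a a' b b' = var_pow (\<alpha> + int (a - b') * (int n - 1)) * var_pow (cartan_exp n b' b)
          * subst_square (c * drop_prod (mset_set {b'..<a}) n)"
        using \<epsilon> n c by (simp add: crossing_def R_matrix_theta mult_ac)
      also have "var_pow (\<alpha> + int (a - b') * (int n - 1)) * var_pow (cartan_exp n b' b)
          = var_pow (\<alpha> + 2 * int b' * int b + (int (a - b') - (int b' + int b + 1)) * (int n - 1))"
        unfolding cartan_exp_def var_pow_add[symmetric] by (rule arg_cong[of _ _ var_pow]) (simp add: algebra_simps)
      finally show "crossing n \<epsilon> a a' b b' = \<dots> * subst_square (c * drop_prod (mset_set {b'..<a}) n)" .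
    next
      show "even (\<alpha> + 2 * int b' * int b + int a * int a' + int b * int b')"
        using \<alpha> by (simp add: mult_ac add_ac)
      have "int (a - b') - (int b' + int b + 1) + int a' + int b' + 1 = 0"
        using b by (simp add: of_nat_diff)
      then show "even (int (a - b') - (int b' + int b + 1) + int a' + int b' + 1)" by (metis dvd_0_right)
      show "(t < a \<longrightarrow> t < b') \<and> (t < a' \<longrightarrow> t < b)" if "t \<notin># mset_set {b'..<a}" for t
        using that b by auto
    qed
  qed
  have "state_term (Transposition.transpose 0 (Suc 0)) (Suc 0) (a # a' # x) (b # b' # x)
      (\<lambda>n. var_pow (\<alpha> + \<beta> * (int n - 1)) * subst_square (c * drop_prod T n))"
    unfolding state_term_def
  proof (rule exI[of _ \<alpha>], rule exI[of _ \<beta>], rule exI[of _ c], rule exI[of _ T], intro conjI allI impI)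
    have "pair_sum (a # a' # x) + pair_sum (b # b' # x) = a * a' + b * b' + 2 * ((a + a') * sum_list x + pair_sum x)"
    proof -
      have "a * sum_list x + a' * sum_list x = b * sum_list x + b' * sum_list x"
        using assms by (simp flip: distrib_right)
      then show ?thesis by (simp add: algebra_simps)
    qed
    then have "\<alpha> + int (pair_sum (a # a' # x)) + int (pair_sum (b # b' # x))
        = (\<alpha> + int a * int a' + int b * int b') + 2 * int ((a + a') * sum_list x + pair_sum x)"
      by (metis (no_types, opaque_lifting) add.assoc of_nat_add of_nat_mult of_nat_numeral)
    then show "even (\<alpha> + int (pair_sum (a # a' # x)) + int (pair_sum (b # b' # x)))"
      using \<alpha> by (metis dvd_add dvd_triv_left)
    have "\<beta> + int (moment (a # a' # x)) + int (moment (b # b' # x)) + int (Suc 0)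
        = (\<beta> + int a' + int b' + 1) + 2 * int (2 * sum_list x + moment x)" by simp
    then show "even (\<beta> + int (moment (a # a' # x)) + int (moment (b # b' # x)) + int (Suc 0))"
      using \<beta> by (metis dvd_add dvd_triv_left)
    fix t p assume "t \<notin># T" "p < length (a # a' # x)" "t < (a # a' # x) ! p"
    then show "t < (b # b' # x) ! Transposition.transpose 0 (Suc 0) p"
      using T[of t] by (cases p rule: nat.exhaust; cases "p - 1") (auto simp: Transposition.transpose_def)
  qed simp
  then show ?thesis using f by (intro exI conjI) (auto intro: state_fun_term)
qed

text \<open>A new first strand of index \<open>a\<close> adds \<open>a * sum_list x\<close> to
  \<open>pair_sum\<close> and \<open>sum_list x\<close> to \<open>moment\<close> at both ends, hence
  an even amount in total.\<close>

lemma state_fun_Cons: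
  assumes "state_fun (Transposition.transpose i (Suc i)) l x y f" "sum_list x = sum_list y"
  shows "state_fun (Transposition.transpose (Suc i) (Suc (Suc i))) l (a # x) (a # y) f"
  using assms(1)
proof induction
  case (add f g)
  obtain \<alpha> \<beta> c T where f: "\<forall>n. f n = var_pow (\<alpha> + \<beta> * (int n - 1)) * subst_square (c * drop_prod T n)"
    "even (\<alpha> + int (pair_sum x) + int (pair_sum y))" "even (\<beta> + int (moment x) + int (moment y) + int l)"
    "\<forall>t p. t \<notin># T \<longrightarrow> p < length x \<longrightarrow> t < x ! p \<longrightarrow> t < y ! Transposition.transpose i (Suc i) p"
    using add.hyps(1) unfolding state_term_def by blast
  have "state_term (Transposition.transpose (Suc i) (Suc (Suc i))) l (a # x) (a # y) f"
    unfolding state_term_def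
  proof (rule exI[of _ \<alpha>], rule exI[of _ \<beta>], rule exI[of _ c], rule exI[of _ T], intro conjI allI impI)
    have "\<alpha> + int (pair_sum (a # x)) + int (pair_sum (a # y))
        = (\<alpha> + int (pair_sum x) + int (pair_sum y)) + 2 * int (a * sum_list x)"
      using assms(2) by simp
    then show "even (\<alpha> + int (pair_sum (a # x)) + int (pair_sum (a # y)))"
      using f(2) by (metis dvd_add dvd_triv_left)
    have "\<beta> + int (moment (a # x)) + int (moment (a # y)) + int l
        = (\<beta> + int (moment x) + int (moment y) + int l) + 2 * int (sum_list x)"
      using assms(2) by simp
    then show "even (\<beta> + int (moment (a # x)) + int (moment (a # y)) + int l)"
      using f(3) by (metis dvd_add dvd_triv_left)
    fix t p assume "t \<notin># T" "p < length (a # x)" "t < (a # x) ! p"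
    then show "t < (a # y) ! Transposition.transpose (Suc i) (Suc (Suc i)) p"
    proof (cases p)
      case (Suc p')
      then have "t < y ! Transposition.transpose i (Suc i) p'"
        using f(4) \<open>t \<notin># T\<close> \<open>p < length (a # x)\<close> \<open>t < (a # x) ! p\<close> by simp
      then show ?thesis using Suc by (auto simp: Transposition.transpose_def split: if_splits)
    qed (simp add: Transposition.transpose_def)
  qed (use f in simp)
  then show ?case using add.IH by (rule state_fun.add)
qed (rule state_fun.zero)

lemma letter_state:
  assumes "Suc i < length x" "length z = length x"
  shows "\<exists>f. state_fun (Transposition.transpose i (Suc i)) (Suc 0) x z f \<and>
    (\<forall>n. x \<in> basis n (length x) \<longrightarrow> z \<in> basis n (length x) \<longrightarrow> f n = letter_op n (i, \<epsilon>) x z)"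
  using assms
proof (induction i arbitrary: x z)
  case 0
  then obtain l where "length x = Suc (Suc l)" "length z = Suc (Suc l)"
    by (auto simp: Suc_less_eq2 gr0_conv_Suc)
  then obtain a a' x' b b' z' where eq: "x = a # a' # x'" "z = b # b' # z'"
    by (auto simp: length_Suc_conv)
  show ?case
  proof (cases "a + a' = b + b' \<and> x' = z'")
    case True
    then show ?thesis using crossing_state[of a a' b b' x' \<epsilon>] by (auto simp: eq letter_op_0)
  next
    case False
    then have "letter_op n (0, \<epsilon>) x z = 0" for n
      by (auto simp: eq letter_op_0 dest: crossing_weight)
    then show ?thesis by (intro exI[of _ "\<lambda>n. 0"]) (simp add: state_fun.zero)
  qed
next
  case (Suc i)
  then obtain l where l: "length x = Suc l" "length z = Suc l" "Suc i < l"
    by (auto simp: Suc_less_eq2)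
  then obtain a x' b z' where eq: "x = a # x'" "z = b # z'"
    by (auto simp: length_Suc_conv)
  show ?case
  proof (cases "a = b \<and> sum_list x' = sum_list z'")
    case True
    then obtain f where "state_fun (Transposition.transpose i (Suc i)) (Suc 0) x' z' f"
      and f: "\<forall>n. x' \<in> basis n (length x') \<longrightarrow> z' \<in> basis n (length x') \<longrightarrow> f n = letter_op n (i, \<epsilon>) x' z'"
      using Suc.IH[of x' z'] l eq by auto
    then have "state_fun (Transposition.transpose (Suc i) (Suc (Suc i))) (Suc 0) x z f"
      using state_fun_Cons True eq by blast
    then show ?thesis using f True by (intro exI[of _ f]) (auto simp: eq letter_op_Suc)
  next
    case False
    then have "letter_op n (Suc i, \<epsilon>) x z = 0" for n
      using letter_op_weight[of n i \<epsilon> x' z'] l by (auto simp: eq letter_op_Suc)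
    then show ?thesis by (intro exI[of _ "\<lambda>n. 0"]) (simp add: state_fun.zero)
  qed
qed

section \<open>The permutation of a braid\<close>

lemma braid_perm_Nil [simp]: "braid_perm [] = id"
  by (simp add: braid_perm_def)

lemma braid_perm_Cons:
  "braid_perm ((i, \<epsilon>) # w) = braid_perm w \<circ> Transposition.transpose i (Suc i)"
proof -
  have "fold (\<lambda>(i, \<epsilon>) \<pi>. Transposition.transpose i (Suc i) \<circ> \<pi>) w \<pi> =
      fold (\<lambda>(i, \<epsilon>) \<pi>. Transposition.transpose i (Suc i) \<circ> \<pi>) w id \<circ> \<pi>" for w :: braid_word and \<pi> :: "nat \<Rightarrow> nat"
  proof (induction w arbitrary: \<pi>)
    case (Cons g w)
    obtain i \<epsilon> where g: "g = (i, \<epsilon>)" by (cases g)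
    show ?case
      using Cons.IH[of "Transposition.transpose i (Suc i) \<circ> \<pi>"] Cons.IH[of "Transposition.transpose i (Suc i)"]
      by (simp add: g comp_assoc)
  qed simp
  from this[of w "Transposition.transpose i (Suc i)"] show ?thesis by (simp add: braid_perm_def)
qed

lemma braid_perm_permutes:
  "\<forall>(i, \<epsilon>)\<in>set w. Suc i < m \<Longrightarrow> braid_perm w permutes {..<m}"
proof (induction w)
  case (Cons g w)
  obtain i \<epsilon> where g: "g = (i, \<epsilon>)" by (cases g)
  have "Transposition.transpose i (Suc i) permutes {..<m}"
    using Cons.prems by (intro permutes_swap_id) (auto simp: g)
  then show ?case
    unfolding g braid_perm_Cons using Cons by (intro permutes_compose) auto
qed (simp add: permutes_id[unfolded id_def] id_def)

lemma sign_braid_perm: "sign (braid_perm w) = (-1) ^ length w"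
proof (induction w)
  case (Cons g w)
  obtain i \<epsilon> where g: "g = (i, \<epsilon>)" by (cases g)
  obtain m where m: "\<forall>(i, \<epsilon>)\<in>set w. Suc i < m"
  proof -
    have "\<forall>(i, \<epsilon>)\<in>set w. Suc i < Suc (Suc (Max (fst ` set w)))"
      by (auto simp: less_Suc_eq_le intro!: Max_ge image_eqI)
    then show thesis by (rule that)
  qed
  have "permutation (braid_perm w)"
    using braid_perm_permutes[OF m] permutation_permutes by blast
  then have "sign (braid_perm (g # w)) = sign (braid_perm w) * sign (Transposition.transpose i (Suc i))"
    unfolding g braid_perm_Cons by (intro sign_compose permutation_swap_id)
  then show ?case by (simp add: sign_swap_id Cons.IH)
qed simp

lemma sign_cycle_of_list: "distinct cs \<Longrightarrow> cs \<noteq> [] \<Longrightarrow> sign (cycle_of_list cs) = (-1) ^ (length cs - 1)"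
proof (induction cs rule: cycle_of_list.induct)
  case (1 i j cs)
  have "sign (cycle_of_list (i # j # cs)) = - sign (cycle_of_list (j # cs))"
    unfolding cycle_of_list.simps
    using 1 by (subst sign_compose[OF permutation_swap_id permutation_of_cycle]) (simp add: sign_swap_id)
  also have "\<dots> = - ((-1) ^ length cs)" using 1 by simp
  finally show ?case by (simp only:) simp
qed simp_all

text \<open>The orbit of 0 runs through all m + 1 points, so the permutation is the cycle
  \<open>cs\<close> of that length.\<close>

lemma sign_transitive:
  assumes \<sigma>: "\<sigma> permutes {..<Suc m}" and trans: "\<forall>p<Suc m. \<exists>k. (\<sigma> ^^ k) 0 = p"
  shows "sign \<sigma> = (-1) ^ m"
proof -
  define cs where "cs = map (\<lambda>k. (\<sigma> ^^ k) 0) [0..<Suc m]"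
  have in_m: "(\<sigma> ^^ k) 0 < Suc m" for k
    by (induction k) (use permutes_in_image[OF \<sigma>] in auto)
  \<comment> \<open>If 0 returned after d steps, its orbit would have at most d points, but it has m
    + 1.\<close>
  have return: "Suc m \<le> d" if d: "0 < d" "(\<sigma> ^^ d) 0 = 0" for d
  proof -
    have "(\<sigma> ^^ k) 0 \<in> (\<lambda>k. (\<sigma> ^^ k) 0) ` {..<d}" for k
    proof -
      have "(\<sigma> ^^ (k mod d + d * j)) 0 = (\<sigma> ^^ (k mod d)) 0" for j
      proof (induction j)
        case (Suc j)
        have "k mod d + d * Suc j = (k mod d + d * j) + d" by simp
        then show ?case using Suc d by (simp add: funpow_add del: mult_Suc_right)
      qed simp
      from this[of "k div d"] have "(\<sigma> ^^ k) 0 = (\<sigma> ^^ (k mod d)) 0" by simp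
      then show ?thesis using d by auto
    qed
    then have "{..<Suc m} \<subseteq> (\<lambda>k. (\<sigma> ^^ k) 0) ` {..<d}"
      using trans by (metis lessThan_iff subsetI)
    then have "card {..<Suc m} \<le> card {..<d}" by (metis card_image_le card_mono finite_imageI finite_lessThan le_trans)
    then show ?thesis by simp
  qed
  have cancel: "(\<sigma> ^^ (j - i)) 0 = 0" if "i \<le> j" "(\<sigma> ^^ i) 0 = (\<sigma> ^^ j) 0" for i j
  proof -
    have "(\<sigma> ^^ j) 0 = (\<sigma> ^^ i) ((\<sigma> ^^ (j - i)) 0)"
      using that(1) by (metis comp_apply funpow_add le_add_diff_inverse)
    then show ?thesis
      using injD[OF inj_fn[OF permutes_inj[OF \<sigma>], of i], of "(\<sigma> ^^ (j - i)) 0" 0] that(2) by simp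
  qed
  have "distinct cs"
  proof -
    have "i = j" if "i \<le> j" "j < Suc m" "(\<sigma> ^^ i) 0 = (\<sigma> ^^ j) 0" for i j
      using return[OF _ cancel[OF that(1,3)]] that by linarith
    then have "inj_on (\<lambda>k. (\<sigma> ^^ k) 0) {0..<Suc m}"
      by (intro inj_onI) (metis atLeastLessThan_iff nle_le)
    then show ?thesis by (simp add: cs_def distinct_map del: upt_Suc)
  qed
  have set_cs: "set cs = {..<Suc m}"
    by (rule card_subset_eq) (use in_m \<open>distinct cs\<close> distinct_card[of cs] in \<open>auto simp: cs_def simp del: upt_Suc\<close>)
  have "(\<sigma> ^^ Suc m) 0 = 0"
  proof -
    have "(\<sigma> ^^ Suc m) 0 \<in> set cs" using in_m set_cs by blast
    then obtain i where i: "i < Suc m" "(\<sigma> ^^ Suc m) 0 = (\<sigma> ^^ i) 0" by (auto simp: cs_def simp del: upt_Suc)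
    \<comment> \<open>Cancelling the first i steps gives a return after m + 1 - i steps, which
      \<open>return\<close> excludes unless i = 0.\<close>
    then have "i = 0" using return[OF _ cancel[of i "Suc m"]] by fastforce
    then show ?thesis using i by (simp only: funpow_0)
  qed
  then have "map \<sigma> cs = rotate1 cs"
    by (intro nth_equalityI) (auto simp: cs_def nth_rotate1 mod_Suc simp del: upt_Suc)
  then have "map \<sigma> cs = map (cycle_of_list cs) cs"
    using cyclic_rotation[OF \<open>distinct cs\<close>, of 1] by simp
  then have "\<sigma> p = cycle_of_list cs p" for p
    using set_cs id_outside_supp[of p cs] permutes_not_in[OF \<sigma>, of p] by (cases "p \<in> set cs") auto
  then have "\<sigma> = cycle_of_list cs" by blast
  then show ?thesis using sign_cycle_of_list[OF \<open>distinct cs\<close>] by (simp add: cs_def)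
qed

text \<open>Two ways to compute the sign of the permutation: each letter is a transposition, and
  connectedness of the closure makes the whole a cycle. The parity makes the coefficient of n - 1 in
  the exponent of v even.\<close>

lemma braid_length_parity:
  assumes "\<forall>(i, \<epsilon>)\<in>set w. Suc i < Suc m" "\<forall>p<Suc m. \<exists>k. (braid_perm w ^^ k) 0 = p"
  shows "even (length w + m)"
proof -
  have "(-1 :: int) ^ length w = (-1) ^ m"
    using sign_transitive[OF braid_perm_permutes[OF assms(1)] assms(2)] by (simp add: sign_braid_perm)
  then show ?thesis by (simp add: minus_one_power_iff split: if_splits)
qed

section \<open>The colored Jones polynomial of a closed braid\<close>

text \<open>Composing letters means summing over intermediate states. The sum is taken over a finite
  set \<open>Z\<close> independent of n and compared with the sum over \<open>basis n m\<close>: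
  states of \<open>Z\<close> with too large an index contribute 0 by
  \<open>state_fun_vanish\<close>, and basis states outside \<open>Z\<close> by conservation of
  weight.\<close>

lemma braid_state:
  assumes "\<forall>(i, \<epsilon>)\<in>set w. Suc i < m" "length x = m" "length y = m"
  shows "\<exists>f. state_fun (braid_perm w) (length w) x y f \<and>
    (\<forall>n. x \<in> basis n m \<longrightarrow> y \<in> basis n m \<longrightarrow> f n = braid_op n m w x y)"
  using assms(1,2)
proof (induction w arbitrary: x)
  case Nil
  show ?case
  proof (cases "x = y")
    case True
    have "state_term id 0 x y (\<lambda>n. 1)"
      unfolding state_term_def
      by (rule exI[of _ 0], rule exI[of _ 0], rule exI[of _ 1], rule exI[of _ "{#}"])
        (simp add: True drop_prod_def)
    then have "state_fun (braid_perm []) (length ([] :: braid_word)) x y (\<lambda>n. 1)"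
      by (simp only: braid_perm_Nil list.size(3) state_fun_term)
    moreover have "1 = braid_op n m [] x y" for n using True by simp
    ultimately show ?thesis by blast
  next
    case False
    then show ?thesis by (intro exI[of _ "\<lambda>n. 0"]) (simp add: state_fun.zero)
  qed
next
  case (Cons g w)
  obtain i \<epsilon> where g: "g = (i, \<epsilon>)" by (cases g)
  then have i: "Suc i < m" using Cons.prems by simp
  define Z where "Z = {z. length z = m \<and> sum_list z = sum_list x}"
  have "a \<le> sum_list z" if "a \<in> set z" for a and z :: "nat list"
    using that by (simp add: member_le_sum_list)
  then have "Z \<subseteq> {z. set z \<subseteq> {..sum_list x} \<and> length z = m}"
    unfolding Z_def by fastforce
  then have fin: "finite Z" by (rule finite_subset) (simp add: finite_lists_length_eq)
  have "\<exists>f. \<forall>z\<in>Z. state_fun (Transposition.transpose i (Suc i)) (Suc 0) x z (f z) \<and>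
      (\<forall>n. x \<in> basis n m \<longrightarrow> z \<in> basis n m \<longrightarrow> f z n = letter_op n (i, \<epsilon>) x z)"
    by (rule bchoice) (use letter_state[of i x] i Cons.prems in \<open>auto simp: Z_def\<close>)
  then obtain f where f: "\<And>z. z \<in> Z \<Longrightarrow> state_fun (Transposition.transpose i (Suc i)) (Suc 0) x z (f z)"
    "\<And>z n. z \<in> Z \<Longrightarrow> x \<in> basis n m \<Longrightarrow> z \<in> basis n m \<Longrightarrow> f z n = letter_op n (i, \<epsilon>) x z" by blast
  have "\<exists>h. \<forall>z\<in>Z. state_fun (braid_perm w) (length w) z y (h z) \<and>
      (\<forall>n. z \<in> basis n m \<longrightarrow> y \<in> basis n m \<longrightarrow> h z n = braid_op n m w z y)"
    by (rule bchoice) (use Cons.IH Cons.prems in \<open>auto simp: Z_def\<close>)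
  then obtain h where h: "\<And>z. z \<in> Z \<Longrightarrow> state_fun (braid_perm w) (length w) z y (h z)"
    "\<And>z n. z \<in> Z \<Longrightarrow> z \<in> basis n m \<Longrightarrow> y \<in> basis n m \<Longrightarrow> h z n = braid_op n m w z y" by blast
  have perm: "braid_perm w permutes {..<m}" using Cons.prems by (intro braid_perm_permutes) simp
  show ?case
  proof (intro exI[of _ "\<lambda>n. \<Sum>z\<in>Z. f z n * h z n"] conjI allI impI)
    have "state_fun (braid_perm w \<circ> Transposition.transpose i (Suc i)) (Suc 0 + length w) x y (\<lambda>n. f z n * h z n)"
      if z: "z \<in> Z" for z
    proof (rule state_fun_mult[OF f(1)[OF z] h(1)[OF z]])
      show "Transposition.transpose i (Suc i) p < length z" if "p < length x" for p
        using that z i Cons.prems by (auto simp: Z_def Transposition.transpose_def)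
    qed
    then show "state_fun (braid_perm (g # w)) (length (g # w)) x y (\<lambda>n. \<Sum>z\<in>Z. f z n * h z n)"
      by (intro state_fun_sum) (simp add: g braid_perm_Cons)
  next
    fix n assume x: "x \<in> basis n m" and y: "y \<in> basis n m"
    have outside: "h z n = 0" if "z \<in> Z" "z \<notin> basis n m" for z
      by (rule state_fun_vanish[OF h(1)[OF that(1)] that(2) y])
        (use that permutes_in_image[OF perm] in \<open>auto simp: Z_def\<close>)
    have weight: "letter_op n (i, \<epsilon>) x z = 0" if "z \<in> basis n m" "z \<notin> Z" for z
      using letter_op_weight[of n i \<epsilon> x z] that x i by (auto simp: Z_def basis_length)
    have "(\<Sum>z\<in>Z. f z n * h z n) = (\<Sum>z\<in>Z \<inter> basis n m. f z n * h z n)"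
      by (rule sum.mono_neutral_right) (use fin outside in auto)
    also have "\<dots> = (\<Sum>z\<in>Z \<inter> basis n m. letter_op n g x z * braid_op n m w z y)"
      using x y f h by (intro sum.cong refl) (simp add: g)
    also have "\<dots> = (\<Sum>z\<in>basis n m. letter_op n g x z * braid_op n m w z y)"
      by (rule sum.mono_neutral_left) (use finite_basis weight in \<open>auto simp: g\<close>)
    finally show "(\<Sum>z\<in>Z. f z n * h z n) = braid_op n m (g # w) x y" by simp
  qed
qed

section \<open>Diagonal states and the resulting expansion\<close>

lemma K_list_eq: "K_list n x = var_pow (int (length x) * (int n - 1) - 2 * int (sum_list x))"
  by (induction x) (simp_all add: K_list_def K_weight_def algebra_simps flip: var_pow_add)

text \<open>The set of the strands whose index exceeds \<open>t\<close> cannot be stable under a transitive permutation,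
  as the open strand has index \<open>0\<close>. Hence there is a drop at each \<open>t\<close> below a given index.\<close>

lemma drop_exists:
  fixes x :: "nat list"
  assumes \<sigma>: "\<sigma> permutes {..<m}" and trans: "\<forall>p<m. \<exists>k. (\<sigma> ^^ k) 0 = p"
    and stable: "\<And>p. p < m \<Longrightarrow> t < x ! p \<Longrightarrow> t < x ! \<sigma> p"
    and "x ! 0 = 0" "p < m"
  shows "x ! p \<le> t"
proof -
  define U where "U = {p. p < m \<and> t < x ! p}"
  have "\<sigma> ` U \<subseteq> U" using stable permutes_in_image[OF \<sigma>] by (auto simp: U_def)
  moreover have "finite U" by (simp add: U_def)
  moreover have "inj_on \<sigma> U" using permutes_inj[OF \<sigma>] by (rule inj_on_subset) simp
  ultimately have "\<sigma> ` U = U" by (simp add: endo_inj_surj)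
  then have step: "p \<in> U" if "\<sigma> p \<in> U" for p
    using that permutes_inj[OF \<sigma>] by (metis image_iff inj_eq)
  have "(\<sigma> ^^ k) 0 \<notin> U" for k
  proof (induction k)
    case 0
    show ?case using assms(4) by (simp add: U_def)
  next
    case (Suc k)
    then show ?case using step by auto
  qed
  then have "p \<notin> U" using trans \<open>p < m\<close> by metis
  then show ?thesis using \<open>p < m\<close> by (simp add: U_def)
qed

text \<open>With equal ends, \<open>pair_sum\<close> and \<open>moment\<close> count twice, so
  \<alpha> is even and \<beta> has the parity of \<open>l\<close>. The factor K contributes
  \<open>length x\<close> to \<beta>, which makes it even as well. By \<open>drop_exists\<close>
  every \<open>t < M\<close> occurs in \<open>T\<close>, so (X;q)_M divides the term.\<close>

lemma state_term_diagonal: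
  assumes f: "state_term \<sigma> l (0 # x) (0 # x) f"
    and \<sigma>: "\<sigma> permutes {..<Suc (length x)}" "\<forall>p<Suc (length x). \<exists>k. (\<sigma> ^^ k) 0 = p"
    and l: "even (l + length x)" and M: "\<forall>t<M. \<exists>a\<in>set x. t < a"
  shows "\<exists>g. pochhammer_sum M g \<and> (\<forall>n. f n * K_list n x = subst_square (g n))"
proof -
  obtain \<alpha> \<beta> c T where f: "\<And>n. f n = var_pow (\<alpha> + \<beta> * (int n - 1)) * subst_square (c * drop_prod T n)"
    and \<alpha>: "even (\<alpha> + int (pair_sum (0 # x)) + int (pair_sum (0 # x)))"
    and \<beta>: "even (\<beta> + int (moment (0 # x)) + int (moment (0 # x)) + int l)"
    and T: "\<And>t p. t \<notin># T \<Longrightarrow> p < length (0 # x) \<Longrightarrow> t < (0 # x) ! p \<Longrightarrow> t < (0 # x) ! \<sigma> p"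
    using f unfolding state_term_def by metis
  have "\<forall>t<M. t \<in># T"
  proof (intro allI impI, rule ccontr)
    fix t assume "t < M" "t \<notin># T"
    then obtain p where p: "p < length x" "t < x ! p" using M by (metis in_set_conv_nth)
    have "(0 # x) ! Suc p \<le> t"
      by (rule drop_exists[OF \<sigma>]) (use T[OF \<open>t \<notin># T\<close>] p in auto)
    then show False using p by simp
  qed
  have "even \<alpha>" using \<alpha> by simp
  then obtain a where a: "\<alpha> = 2 * a" by blast
  have "even (\<beta> + int (length x))" using \<beta> l by simp
  then obtain b where b: "\<beta> + int (length x) = 2 * b" by blast
  define g where "g n = var_pow (b * (int n - 1)) * (var_pow (a - int (sum_list x)) * c * drop_prod T n)" for n
  have "f n * K_list n x = subst_square (g n)" for n
  proof -
    have "f n * K_list n x = (var_pow (\<alpha> + \<beta> * (int n - 1)) * var_pow (int (length x) * (int n - 1) - 2 * int (sum_list x)))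
        * subst_square (c * drop_prod T n)"
      unfolding f K_list_eq by (simp only: mult_ac)
    also have "var_pow (\<alpha> + \<beta> * (int n - 1)) * var_pow (int (length x) * (int n - 1) - 2 * int (sum_list x))
        = var_pow (2 * (b * (int n - 1)) + 2 * (a - int (sum_list x)))"
    proof -
      have "\<alpha> + \<beta> * (int n - 1) + (int (length x) * (int n - 1) - 2 * int (sum_list x))
          = 2 * a + (\<beta> + int (length x)) * (int n - 1) - 2 * int (sum_list x)"
        unfolding a by (simp add: algebra_simps)
      also have "\<dots> = 2 * (b * (int n - 1)) + 2 * (a - int (sum_list x))"
        unfolding b by (simp add: algebra_simps)
      finally show ?thesis by (simp flip: var_pow_add)
    qed
    finally show ?thesis
      by (simp add: g_def subst_square_mult subst_square_var_pow var_pow_add mult_ac)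
  qed
  moreover have "pochhammer_sum M g"
    using pochhammer_sum_drop_prod_initial[OF \<open>\<forall>t<M. t \<in># T\<close>] unfolding g_def by blast
  ultimately show ?thesis by blast
qed

lemma state_fun_diagonal:
  assumes f: "state_fun \<sigma> l (0 # x) (0 # x) f"
    and \<sigma>: "\<sigma> permutes {..<Suc (length x)}" "\<forall>p<Suc (length x). \<exists>k. (\<sigma> ^^ k) 0 = p"
    and l: "even (l + length x)" and M: "\<forall>t<M. \<exists>a\<in>set x. t < a"
  shows "\<exists>g. pochhammer_sum M g \<and> (\<forall>n. f n * K_list n x = subst_square (g n))"
  using f
proof induction
  case zero
  then show ?case by (intro exI[of _ "\<lambda>n. 0"]) (simp add: pochhammer_sum_0)
next
  case (add f f')
  then obtain g g' where "pochhammer_sum M g" "\<forall>n. f n * K_list n x = subst_square (g n)"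
    "pochhammer_sum M g'" "\<forall>n. f' n * K_list n x = subst_square (g' n)"
    using state_term_diagonal[OF add.hyps(1) \<sigma> l M] by blast
  then show ?case
    by (intro exI[of _ "\<lambda>n. g n + g' n"]) (simp add: pochhammer_sum_add distrib_right subst_square_add)
qed

text \<open>The expansion of the state \<open>x\<close> starts at its largest index. So only the
  finitely many states with indices up to k contribute to the k-th coefficient, and the sum over all
  states makes sense independently of n.\<close>

lemma open_trace_expansion:
  assumes w: "\<forall>(i, \<epsilon>)\<in>set w. Suc i < Suc m" and trans: "\<forall>p<Suc m. \<exists>k. (braid_perm w ^^ k) 0 = p"
  shows "\<exists>a. \<forall>n>0. open_trace n m w 0 = subst_square (\<Sum>k<n. a k * poch n k)"
proof -
  \<comment> \<open>The least color that admits \<open>x\<close>: one more than the largest index,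
    or 0 for the empty list. Hence the expansion of \<open>x\<close> starts at
    \<open>M x - 1\<close>.\<close>
  define M where "M x = (LEAST n. \<forall>a\<in>set x. a < n)" for x :: "nat list"
  have basis_M: "x \<in> basis n m \<longleftrightarrow> length x = m \<and> M x \<le> n" for x n
  proof -
    have "\<exists>n. \<forall>a\<in>set x. a < n" using finite_nat_set_iff_bounded[of "set x"] by auto
    then have "\<forall>a\<in>set x. a < M x" unfolding M_def by (rule LeastI_ex)
    moreover have "M x \<le> n" if "\<forall>a\<in>set x. a < n" unfolding M_def using that by (rule Least_le)
    ultimately show ?thesis by (fastforce simp: basis_def)
  qed
  have "\<exists>a. (\<forall>k. Suc k < M x \<longrightarrow> a k = 0) \<and> (\<forall>n>0. x \<in> basis n m \<longrightarrow>
      braid_op n (Suc m) w (0 # x) (0 # x) * K_list n x = subst_square (\<Sum>k<n. a k * poch n k))"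
    if x: "length x = m" for x
  proof -
    obtain f where f: "state_fun (braid_perm w) (length w) (0 # x) (0 # x) f"
      "\<forall>n. 0 # x \<in> basis n (Suc m) \<longrightarrow> f n = braid_op n (Suc m) w (0 # x) (0 # x)"
      using braid_state[OF w, of "0 # x" "0 # x"] x by auto
    have "\<forall>t<M x - 1. \<exists>a\<in>set x. t < a"
    proof (intro allI impI, rule ccontr)
      fix t assume t: "t < M x - 1" "\<not> (\<exists>a\<in>set x. t < a)"
      then have "\<forall>a\<in>set x. a < Suc t" by (auto simp: not_less less_Suc_eq_le)
      then have "M x \<le> Suc t" unfolding M_def by (rule Least_le)
      then show False using t by simp
    qed
    then obtain g where g: "pochhammer_sum (M x - 1) g" "\<forall>n. f n * K_list n x = subst_square (g n)"
      using state_fun_diagonal[OF f(1), of "M x - 1"] x braid_perm_permutes[OF w] trans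
        braid_length_parity[OF w trans] by auto
    then obtain a where a: "\<forall>k<M x - 1. a k = 0" "\<forall>n>0. g n = (\<Sum>k<n. a k * poch n k)"
      by (auto simp: pochhammer_sum_def)
    have "braid_op n (Suc m) w (0 # x) (0 # x) * K_list n x = subst_square (\<Sum>k<n. a k * poch n k)"
      if "0 < n" "x \<in> basis n m" for n
      using f(2) g(2) a(2) that by (metis Cons_in_basis)
    then show ?thesis using a(1) by (intro exI[of _ a]) auto
  qed
  then have "\<exists>a. \<forall>x\<in>{x. length x = m}. (\<forall>k. Suc k < M x \<longrightarrow> a x k = 0) \<and> (\<forall>n>0. x \<in> basis n m \<longrightarrow>
      braid_op n (Suc m) w (0 # x) (0 # x) * K_list n x = subst_square (\<Sum>k<n. a x k * poch n k))"
    by (intro bchoice) simp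
  then obtain a where a: "\<And>x k. length x = m \<Longrightarrow> Suc k < M x \<Longrightarrow> a x k = 0"
    "\<And>x n. 0 < n \<Longrightarrow> x \<in> basis n m \<Longrightarrow>
      braid_op n (Suc m) w (0 # x) (0 # x) * K_list n x = subst_square (\<Sum>k<n. a x k * poch n k)"
    by (auto simp: basis_M)
  have expansion: "open_trace n m w 0 = subst_square (\<Sum>k<n. (\<Sum>x\<in>basis (Suc k) m. a x k) * poch n k)"
    if n: "0 < n" for n
  proof -
    have "open_trace n m w 0 = (\<Sum>x\<in>basis n m. subst_square (\<Sum>k<n. a x k * poch n k))"
      unfolding open_trace_def by (intro sum.cong refl a(2)[OF n])
    also have "\<dots> = subst_square (\<Sum>k<n. (\<Sum>x\<in>basis n m. a x k) * poch n k)"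
      unfolding subst_square_sum[symmetric] by (subst sum.swap) (simp add: sum_distrib_right)
    also have "(\<Sum>k<n. (\<Sum>x\<in>basis n m. a x k) * poch n k) = (\<Sum>k<n. (\<Sum>x\<in>basis (Suc k) m. a x k) * poch n k)"
    proof (rule sum.cong[OF refl])
      fix k assume "k \<in> {..<n}"
      \<comment> \<open>A state of \<open>basis n m\<close> with an index above k has
        \<open>Suc k < M x\<close>, so its coefficient at k is 0. The n-dependent range can be cut
        down.\<close>
      then have "(\<Sum>x\<in>basis n m. a x k) = (\<Sum>x\<in>basis (Suc k) m. a x k)"
        by (intro sum.mono_neutral_right finite_basis) (auto simp: basis_M not_le intro!: a(1))
      then show "(\<Sum>x\<in>basis n m. a x k) * poch n k = (\<Sum>x\<in>basis (Suc k) m. a x k) * poch n k"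
        by simp
    qed
    finally show ?thesis .
  qed
  show ?thesis
  proof (intro exI allI impI)
    fix n :: nat assume "0 < n"
    then show "open_trace n m w 0 = subst_square (\<Sum>k<n. (\<Sum>x\<in>basis (Suc k) m. a x k) * poch n k)"
      by (rule expansion)
  qed
qed

text \<open>The open trace at index 0 is the quotient of the quantum trace by the unknot value [n].
  As [n] is nonzero for positive n and substitution of v^2 is injective, the definite description
  picks out this quotient.\<close>

lemma closed_braid_jones_expansion:
  "\<exists>a. \<forall>n>0. closed_braid_jones b n = (\<Sum>k<n. a k * poch n k)"
proof -
  obtain m w where b: "Rep_knot_braid b = (m, w)" by (cases "Rep_knot_braid b")
  have mw: "0 < m" "\<forall>(i, \<epsilon>)\<in>set w. Suc i < m" "\<forall>p<m. \<exists>k. (braid_perm w ^^ k) 0 = p"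
    using Rep_knot_braid[of b] by (auto simp: b)
  then obtain l where l: "m = Suc l" by (cases m) auto
  obtain a where a: "\<forall>n>0. open_trace n l w 0 = subst_square (\<Sum>k<n. a k * poch n k)"
    using open_trace_expansion mw l by blast
  have "closed_braid_jones b n = (\<Sum>k<n. a k * poch n k)" if n: "0 < n" for n
    unfolding closed_braid_jones_def b prod.case
  proof (rule the_equality)
    show "subst_square (\<Sum>k<n. a k * poch n k) * quantum_trace n 1 [] = quantum_trace n m w"
      using a n quantum_trace_open[of w l n] mw l by simp
    then show "P = (\<Sum>k<n. a k * poch n k)"
      if "subst_square P * quantum_trace n 1 [] = quantum_trace n m w" for P
      using that qint_nonzero[OF n] subst_square_inject unfolding quantum_trace_unknot
      by (metis mult_cancel_right)
  qed
  then show ?thesis by (intro exI[of _ a]) simp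
qed

theorem corollary1p4:
  fixes K :: "(complex \<times> complex) set"
  assumes "knot K"
  shows "\<exists>a :: nat \<Rightarrow> laurent. \<forall>n>0.
           colored_jones K n =
             Sum_any (\<lambda>k. a k * qpochhammer (var_pow (- int n + 1)) (var_pow 1) k)"
proof -
  \<comment> \<open>The expansion holds for every closed braid, in particular for the one chosen in
    \<open>colored_jones\<close>.\<close>
  obtain a where a: "\<forall>n>0. colored_jones K n = (\<Sum>k<n. a k * poch n k)"
    using closed_braid_jones_expansion unfolding colored_jones_def by blast
  have "Sum_any (\<lambda>k. a k * poch n k) = (\<Sum>k<n. a k * poch n k)" if "0 < n" for n
  proof (rule Sum_any.expand_superset)
    have "k < n" if "a k * poch n k \<noteq> 0" for k
      using that poch_eq_0[OF \<open>0 < n\<close>, of k] by (cases "n \<le> k") simp_all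
    then show "{k. a k * poch n k \<noteq> 0} \<subseteq> {..<n}" by blast
  qed simp
  then show ?thesis using a unfolding poch_def[symmetric] by (intro exI[of _ a]) simp
qed

end
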